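(* Let $d\ge1$ and let $\eta$ be a positive integer-valued random variable (so $\eta\ge 1$ a.s.). Suppose that for some positive $\delta<d$ and for all $n$ large enough $$\mathbf{P}[\eta\ge(2d)^n]\ge n^{-\delta}.$$ Consider the frog model on $\mathbb{Z}^d$ whose initial numbers of particles at the sites are i.i.d. with the law of $\eta$. Then its asymptotic shape $\mathsf{A}_\eta$ equals $$\mathcal{D}=\{x=(x^{(1)},\dots,x^{(d)})\in\mathbb{R}^d : |x^{(1)}|+\cdots+|x^{(d)}|\le1\};$$ that is, for any $0<\varepsilon<1$, almost surely $(1-\varepsilon)\mathcal{D}\subset\bar\xi_n/n\subset(1+\varepsilon)\mathcal{D}$ for all $n$ large enough.
   Context: Frog model with random initial configuration. Let $\{\eta_x : x\in\mathbb{Z}^d\}$ be i.i.d. random variables with the law of $\eta$; at time $0$ site $x$ contains $\eta_x$ particles. All particles are sleeping except those at the origin, which are active. Active particles perform independent discrete-time simple random walks on $\mathbb{Z}^d$ (each step uniform among the $2d$ nearest neighbours), independent of the initial configuration, and do not interact; when an active particle jumps onto a site containing sleeping particles, all of these become active and start their own independent simple random walks. Formally, let $\{S^{x,i} : x\in\mathbb{Z}^d, i\ge1\}$ be independent simple random walks, independent of $(\eta_x)$, with $S^{x,i}_0=x$ (trajectory of the $i$-th particle of $x$ counted from its waking time), let $t(x,z)=\min\{n\ge0 : S^{x,i}_n=z\text{ for some }1\le i\le\eta_x\}$ (with $\min\emptyset=\infty$), let $T(x,z)=\inf\{\sum_{j=1}^k t(x_{j-1},x_j) : x_0=x,\dots,x_k=z\text{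 for some }k\}$, let $\xi_n=\{y\in\mathbb{Z}^d : T(0,y)\le n\}$ be the set of sites whose particles have been awakened by time $n$, and let $\bar\xi_n=\bigcup_{x\in\xi_n}(x+(-1/2,1/2]^d)\subset\mathbb{R}^d$. Asymptotic shape. $\mathsf{A}_\eta$ denotes the (deterministic) compact convex set, if it exists, such that for any $0<\varepsilon<1$, almost surely, $(1-\varepsilon)\mathsf{A}_\eta\subset\bar\xi_n/n\subset(1+\varepsilon)\mathsf{A}_\eta$ for all $n$ large enough. *)

theory Defs
  imports "HOL-Probability.Probability" "HOL-Library.Extended_Nat"
begin

text \<open>The lattice is the type \<open>int ^ 'd\<close> and the ambient space is \<open>real ^ 'd\<close>; the dimension is
  \<open>CARD('d)\<close>, which is arbitrary and at least one.\<close>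

definition unit_steps :: "(int ^ 'd) set" where
  "unit_steps = {e. \<exists>k. e = axis k 1 \<or> e = axis k (- 1)}"

definition simple_random_walk ::
  "'w measure \<Rightarrow> int ^ 'd \<Rightarrow> (nat \<Rightarrow> 'w \<Rightarrow> int ^ 'd) \<Rightarrow> bool" where
  "simple_random_walk M x W \<longleftrightarrow>
     W 0 \<in> M \<rightarrow>\<^sub>M count_space UNIV \<and> (AE \<omega> in M. W 0 \<omega> = x) \<and>
     prob_space.indep_vars M (\<lambda>_. count_space UNIV) (\<lambda>n \<omega>. W (Suc n) \<omega> - W n \<omega>) UNIV \<and>
     (\<forall>n. distr M (count_space UNIV) (\<lambda>\<omega>. W (Suc n) \<omega> - W n \<omega>)
            = measure_pmf (pmf_of_set unit_steps))"

text \<open>\<open>eta x\<close> is the initial number of particles at \<open>x\<close>, and \<open>S x i\<close> is the trajectory of the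
  \<open>i\<close>-th particle of \<open>x\<close>, counted from its waking time; only the indices \<open>i \<ge> 1\<close> are used.
  Independence of the walks is independence of the whole trajectories, as random elements of the
  path space with the product sigma-algebra. \<open>indep_var\<close> requires a common value type, so independence of
  \<open>eta\<close> from the walks is stated for the generated sigma-algebras.\<close>

locale frog_model = prob_space M
  for M :: "'w measure" and law :: "nat pmf"
    and eta :: "int ^ 'd \<Rightarrow> 'w \<Rightarrow> nat"
    and S :: "int ^ 'd \<Rightarrow> nat \<Rightarrow> nat \<Rightarrow> 'w \<Rightarrow> int ^ 'd" +
  assumes eta_indep: "indep_vars (\<lambda>_. count_space UNIV) eta UNIV"
    and eta_law: "\<And>x. distr M (count_space UNIV) (eta x) = measure_pmf law"
    and walk: "\<And>x i. i \<ge> 1 \<Longrightarrow> simple_random_walk M x (S x i)"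
    and walks_indep:
      "indep_vars (\<lambda>_. PiM UNIV (\<lambda>_::nat. count_space UNIV))
         (\<lambda>(x, i) \<omega>. \<lambda>n. S x i n \<omega>) (UNIV \<times> {1..})"
    and eta_walks_indep:
      "indep_set
         (sets (vimage_algebra (space M) (\<lambda>\<omega> x. eta x \<omega>) (PiM UNIV (\<lambda>_. count_space UNIV))))
         (sets (vimage_algebra (space M)
           (\<lambda>\<omega>. \<lambda>(x, i)\<in>UNIV \<times> {1..}. \<lambda>n. S x i n \<omega>)
           (PiM (UNIV \<times> {1..}) (\<lambda>_. PiM UNIV (\<lambda>_::nat. count_space UNIV)))))"

text \<open>In \<open>enat\<close> the infimum of the empty set is \<open>\<infinity>\<close>.\<close>

definition hit_time ::
  "(int ^ 'd \<Rightarrow> 'w \<Rightarrow> nat) \<Rightarrow> (int ^ 'd \<Rightarrow> nat \<Rightarrow> nat \<Rightarrow> 'w \<Rightarrow> int ^ 'd) \<Rightarrow>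
     'w \<Rightarrow> int ^ 'd \<Rightarrow> int ^ 'd \<Rightarrow> enat" where
  "hit_time eta S \<omega> x z = Inf {enat n | n. \<exists>i. 1 \<le> i \<and> i \<le> eta x \<omega> \<and> S x i n \<omega> = z}"

definition passage_time ::
  "(int ^ 'd \<Rightarrow> 'w \<Rightarrow> nat) \<Rightarrow> (int ^ 'd \<Rightarrow> nat \<Rightarrow> nat \<Rightarrow> 'w \<Rightarrow> int ^ 'd) \<Rightarrow>
     'w \<Rightarrow> int ^ 'd \<Rightarrow> int ^ 'd \<Rightarrow> enat" where
  "passage_time eta S \<omega> x z =
     Inf {(\<Sum>j=1..k. hit_time eta S \<omega> (y (j - 1)) (y j)) | (k::nat) y. y 0 = x \<and> y k = z}"

definition awakened ::
  "(int ^ 'd \<Rightarrow> 'w \<Rightarrow> nat) \<Rightarrow> (int ^ 'd \<Rightarrow> nat \<Rightarrow> nat \<Rightarrow> 'w \<Rightarrow> int ^ 'd) \<Rightarrow>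
     'w \<Rightarrow> nat \<Rightarrow> (int ^ 'd) set" where
  "awakened eta S \<omega> n = {y. passage_time eta S \<omega> 0 y \<le> enat n}"

definition unit_cell :: "(real ^ 'd) set" where
  "unit_cell = {u. \<forall>k. - 1 / 2 < u $ k \<and> u $ k \<le> 1 / 2}"

definition awakened_region ::
  "(int ^ 'd \<Rightarrow> 'w \<Rightarrow> nat) \<Rightarrow> (int ^ 'd \<Rightarrow> nat \<Rightarrow> nat \<Rightarrow> 'w \<Rightarrow> int ^ 'd) \<Rightarrow>
     'w \<Rightarrow> nat \<Rightarrow> (real ^ 'd) set" where
  "awakened_region eta S \<omega> n =
     (\<Union>x\<in>awakened eta S \<omega> n. (\<lambda>u. (\<chi> k. real_of_int (x $ k)) + u) ` unit_cell)"

definition asymptotic_shape ::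
  "'w measure \<Rightarrow> (int ^ 'd \<Rightarrow> 'w \<Rightarrow> nat) \<Rightarrow> (int ^ 'd \<Rightarrow> nat \<Rightarrow> nat \<Rightarrow> 'w \<Rightarrow> int ^ 'd) \<Rightarrow>
     (real ^ 'd) set \<Rightarrow> bool" where
  "asymptotic_shape M eta S A \<longleftrightarrow> compact A \<and> convex A \<and>
     (\<forall>\<epsilon>. 0 < \<epsilon> \<and> \<epsilon> < 1 \<longrightarrow>
        (AE \<omega> in M. \<forall>\<^sub>F n in sequentially.
           (\<lambda>v. (1 - \<epsilon>) *\<^sub>R v) ` A \<subseteq> (\<lambda>v. (1 / real n) *\<^sub>R v) ` awakened_region eta S \<omega> n \<and>
           (\<lambda>v. (1 / real n) *\<^sub>R v) ` awakened_region eta S \<omega> n \<subseteq> (\<lambda>v. (1 + \<epsilon>) *\<^sub>R v) ` A))"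

text \<open>The asymptotic shape is unique, so the predicate determines the set.\<close>

lemma asymptotic_shape_subset:
  fixes A B :: "(real ^ 'a) set"
  assumes "prob_space M" and A: "asymptotic_shape M eta S A" and B: "asymptotic_shape M eta S B"
  shows "A \<subseteq> B"
proof
  fix x assume x: "x \<in> A"
  interpret prob_space M by fact
  have mem: "((1 - \<epsilon>) / (1 + \<epsilon>)) *\<^sub>R x \<in> B" if e: "0 < \<epsilon>" "\<epsilon> < 1" for \<epsilon>
  proof -
    let ?R = "\<lambda>\<omega> n. (\<lambda>v. (1 / real n) *\<^sub>R v) ` awakened_region eta S \<omega> n"
    define P Q where "P Z = (\<lambda>v. (1 - \<epsilon>) *\<^sub>R v) ` Z" and "Q Z = (\<lambda>v. (1 + \<epsilon>) *\<^sub>R v) ` Z"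
      for Z :: "(real ^ 'a) set"
    have "AE \<omega> in M. \<forall>\<^sub>F n in sequentially. P A \<subseteq> ?R \<omega> n \<and> ?R \<omega> n \<subseteq> Q A"
      using A e by (simp add: asymptotic_shape_def P_def Q_def)
    moreover have "AE \<omega> in M. \<forall>\<^sub>F n in sequentially. P B \<subseteq> ?R \<omega> n \<and> ?R \<omega> n \<subseteq> Q B"
      using B e by (simp add: asymptotic_shape_def P_def Q_def)
    ultimately have "AE \<omega> in M. \<forall>\<^sub>F n::nat in sequentially. P A \<subseteq> Q B"
    proof eventually_elim
      case (elim \<omega>)
      from eventually_conj[OF elim] show ?case
        by (rule eventually_mono) (metis subset_trans)
    qed
    then have "(\<lambda>v. (1 - \<epsilon>) *\<^sub>R v) ` A \<subseteq> (\<lambda>v. (1 + \<epsilon>) *\<^sub>R v) ` B"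
      by (simp flip: P_def Q_def)
    with x obtain b where b: "b \<in> B" "(1 - \<epsilon>) *\<^sub>R x = (1 + \<epsilon>) *\<^sub>R b" by blast
    have "((1 - \<epsilon>) / (1 + \<epsilon>)) *\<^sub>R x = (1 / (1 + \<epsilon>)) *\<^sub>R ((1 - \<epsilon>) *\<^sub>R x)" by simp
    also have "\<dots> = b" unfolding b(2) using e by simp
    finally show ?thesis using b by simp
  qed
  have "((\<lambda>\<epsilon>. ((1 - \<epsilon>) / (1 + \<epsilon>)) *\<^sub>R x) \<longlongrightarrow> ((1 - 0) / (1 + 0)) *\<^sub>R x) (at_right (0::real))"
    by (intro tendsto_intros) auto
  then have lim: "((\<lambda>\<epsilon>. ((1 - \<epsilon>) / (1 + \<epsilon>)) *\<^sub>R x) \<longlongrightarrow> x) (at_right (0::real))" by simp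
  have "closed B" using B by (simp add: asymptotic_shape_def compact_imp_closed)
  then show "x \<in> B"
  proof (rule Lim_in_closed_set[OF _ _ _ lim])
    show "\<forall>\<^sub>F \<epsilon> in at_right (0::real). ((1 - \<epsilon>) / (1 + \<epsilon>)) *\<^sub>R x \<in> B"
      unfolding eventually_at_right_field using mem by (intro exI[of _ 1]) auto
  qed simp
qed

lemma asymptotic_shape_unique:
  assumes "prob_space M" "asymptotic_shape M eta S A" "asymptotic_shape M eta S B"
  shows "A = B"
  using asymptotic_shape_subset[OF assms] asymptotic_shape_subset[OF assms(1,3,2)] by blast

definition cross_polytope :: "(real ^ 'd) set" where
  "cross_polytope = {x. (\<Sum>k\<in>UNIV. \<bar>x $ k\<bar>) \<le> 1}"

end

theory Submission
  imports Defs
begin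

text \<open>Awakening travels at speed at most one in the \<open>\<ell>\<^sup>1\<close> norm, which gives the upper inclusion.
  For the lower one, call a site rich at level \<open>m\<close> if it holds at least \<open>(2d)\<^bsup>2Lm\<^esup>\<close> particles: so
  many that, up to a failure probability exponentially small in \<open>m\<close>, some particle follows a
  geodesic to each site within distance \<open>Lm\<close>. The tail of \<open>\<eta>\<close> makes rich sites of level \<open>m\<close> have
  density at least of order \<open>m\<^bsup>-\<delta>\<^esup>\<close>, and a cube of side \<open>m\<close> has \<open>m\<^bsup>d\<^esup>\<close> sites with \<open>d > \<delta>\<close>, so by
  Borel--Cantelli, once \<open>m\<close> is large, every cube of side \<open>m\<close> in a polynomially large box contains
  one. For the same reason the first walk from the origin, which is unbounded and hence visits \<open>m\<^bsup>d\<^esup>\<close>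
  sites in the ball of radius \<open>m\<^bsup>d\<^esup>\<close>, meets a rich site. From there the rich sites of dyadic levels
  wake each other up, with a total detour of order \<open>n / L\<close> before a site whose level suffices to
  reach everything within distance \<open>n\<close>.\<close>

section \<open>Lattice geometry\<close>

definition l1 :: "int ^ 'd \<Rightarrow> nat" where
  "l1 v = (\<Sum>k\<in>UNIV. nat \<bar>v $ k\<bar>)"

lemma l1_0 [simp]: "l1 0 = 0"
  by (simp add: l1_def)

lemma l1_eq_0_iff: "l1 v = 0 \<longleftrightarrow> v = 0"
  by (auto simp: l1_def vec_eq_iff)

lemma l1_triangle: "l1 (v + w) \<le> l1 v + l1 w"
  unfolding l1_def sum.distrib[symmetric]
proof (intro sum_mono)
  fix k
  have "\<bar>v $ k + w $ k\<bar> \<le> \<bar>v $ k\<bar> + \<bar>w $ k\<bar>" by (rule abs_triangle_ineq)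
  then show "nat \<bar>(v + w) $ k\<bar> \<le> nat \<bar>v $ k\<bar> + nat \<bar>w $ k\<bar>" by simp
qed

lemma l1_minus_commute: "l1 (v - w) = l1 (w - v)"
  by (simp add: l1_def abs_minus_commute)

lemma l1_triangle_diff: "l1 (v - w) \<le> l1 v + l1 w"
  using l1_triangle[of v "- w"] l1_minus_commute[of 0 w] by simp

lemma l1_triangle3: "l1 (u - w) \<le> l1 (u - v) + l1 (v - w)"
  using l1_triangle[of "u - v" "v - w"] by simp

lemma component_le_l1: "\<bar>v $ k\<bar> \<le> int (l1 v)"
proof -
  have "nat \<bar>v $ k\<bar> \<le> l1 v"
    unfolding l1_def by (rule member_le_sum) auto
  then show ?thesis by linarith
qed

lemma l1_le_card_mult:
  fixes v :: "int ^ 'd"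
  assumes "\<And>k. \<bar>v $ k\<bar> \<le> int r"
  shows "l1 v \<le> CARD('d) * r"
proof -
  have "l1 v \<le> (\<Sum>k\<in>(UNIV :: 'd set). r)"
    unfolding l1_def by (intro sum_mono) (use assms in \<open>simp add: nat_le_iff\<close>)
  then show ?thesis by simp
qed

lemma finite_vec_box:
  assumes "finite A"
  shows "finite {v :: 'a ^ 'd. \<forall>k. v $ k \<in> A}"
    and card_vec_box: "card {v :: 'a ^ 'd. \<forall>k. v $ k \<in> A} = card A ^ CARD('d)"
proof -
  have b: "bij_betw vec_lambda ((UNIV :: 'd set) \<rightarrow>\<^sub>E A) {v :: 'a ^ 'd. \<forall>k. v $ k \<in> A}"
    by (rule bij_betwI[where g = vec_nth]) (auto simp: PiE_def)
  show "finite {v :: 'a ^ 'd. \<forall>k. v $ k \<in> A}"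
    using bij_betw_finite[OF b] assms by (simp add: finite_PiE)
  show "card {v :: 'a ^ 'd. \<forall>k. v $ k \<in> A} = card A ^ CARD('d)"
    using bij_betw_same_card[OF b] assms by (simp add: card_PiE)
qed

section \<open>Unit steps and geodesics\<close>

lemma l1_axis: "l1 (axis k c) = nat \<bar>c\<bar>"
proof -
  have "l1 (axis k c) = (\<Sum>j\<in>UNIV. if j = k then nat \<bar>c\<bar> else 0)"
    unfolding l1_def by (intro sum.cong) (auto simp: axis_def)
  then show ?thesis by simp
qed

lemma l1_unit_step: "e \<in> unit_steps \<Longrightarrow> l1 e = 1"
  by (auto simp: unit_steps_def l1_axis)

lemma unit_steps_altdef: "unit_steps = (\<lambda>(k, c). axis k c) ` (UNIV \<times> {1, - 1})"
  by (auto simp: unit_steps_def)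

lemma finite_unit_steps [simp]: "finite (unit_steps :: (int ^ 'd) set)"
  and card_unit_steps: "card (unit_steps :: (int ^ 'd) set) = 2 * CARD('d)"
  and unit_steps_nonempty [simp]: "(unit_steps :: (int ^ 'd) set) \<noteq> {}"
proof -
  have "inj_on (\<lambda>(k :: 'd, c :: int). axis k c) (UNIV \<times> {1, - 1})"
    by (auto simp: inj_on_def axis_eq_axis)
  then show "card (unit_steps :: (int ^ 'd) set) = 2 * CARD('d)"
    unfolding unit_steps_altdef by (simp add: card_image card_cartesian_product)
  show "finite (unit_steps :: (int ^ 'd) set)" "(unit_steps :: (int ^ 'd) set) \<noteq> {}"
    unfolding unit_steps_altdef by simp_all
qed

text \<open>Induction on the norm: a step along a nonzero coordinate with its sign, subtracted from
  \<open>v\<close>, lowers the norm by exactly one. The sequence \<open>e\<close> is total, so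
  beyond index \<open>l1 v\<close> it takes arbitrary unit steps as default values.\<close>

lemma geodesic_exists:
  fixes v :: "int ^ 'd"
  shows "\<exists>e. (\<forall>i. e i \<in> unit_steps) \<and> (\<Sum>i<l1 v. e i) = v"
proof (induction "l1 v" arbitrary: v)
  case 0
  obtain u :: "int ^ 'd" where u: "u \<in> unit_steps"
    using unit_steps_nonempty[where 'd = 'd] ex_in_conv by metis
  have "v = 0" using 0 l1_eq_0_iff[of v] by simp
  with u show ?case by (intro exI[of _ "\<lambda>_. u"]) simp
next
  case (Suc n)
  have "v \<noteq> 0" using Suc(2) by auto
  then obtain k where k: "v $ k \<noteq> 0" by (auto simp: vec_eq_iff)
  define s where "s = sgn (v $ k)"
  define w where "w = v - axis k s"
  have s: "axis k s \<in> unit_steps"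
    using k by (auto simp: s_def unit_steps_def sgn_if)
  have "l1 v = nat \<bar>v $ k\<bar> + (\<Sum>j\<in>UNIV - {k}. nat \<bar>v $ j\<bar>)"
    unfolding l1_def by (simp add: sum.remove)
  moreover have "l1 w = nat \<bar>w $ k\<bar> + (\<Sum>j\<in>UNIV - {k}. nat \<bar>w $ j\<bar>)"
    unfolding l1_def by (simp add: sum.remove)
  moreover have "(\<Sum>j\<in>UNIV - {k}. nat \<bar>w $ j\<bar>) = (\<Sum>j\<in>UNIV - {k}. nat \<bar>v $ j\<bar>)"
    by (intro sum.cong) (auto simp: w_def axis_def)
  moreover have "nat \<bar>v $ k\<bar> = nat \<bar>w $ k\<bar> + 1"
    using k by (auto simp: w_def s_def sgn_if axis_def)
  ultimately have n: "n = l1 w" using Suc(2) by simp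
  from Suc(1)[OF n] obtain e where e: "\<forall>i. e i \<in> unit_steps" "(\<Sum>i<l1 w. e i) = w" by blast
  have "(\<Sum>i<l1 v. (e(n := axis k s)) i) = (\<Sum>i<n. e i) + axis k s"
    unfolding Suc(2)[symmetric] by simp
  also have "\<dots> = v" using e(2) n by (simp add: w_def)
  finally have "(\<Sum>i<l1 v. (e(n := axis k s)) i) = v" .
  moreover have "\<forall>i. (e(n := axis k s)) i \<in> unit_steps" using e(1) s by simp
  ultimately show ?case by (intro exI[of _ "e(n := axis k s)"] conjI)
qed

section \<open>Passage times\<close>

text \<open>\<open>enat\<close> is well ordered, so the infimum of a nonempty set is attained, and a
  finite bound on the hitting time yields an actual visit.\<close>

lemma hit_time_le_iff:
  "hit_time eta S \<omega> x z \<le> enat n \<longleftrightarrow> (\<exists>i m. 1 \<le> i \<and> i \<le> eta x \<omega> \<and> m \<le> n \<and> S x i m \<omega> = z)"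
proof -
  define A where "A = {enat n | n. \<exists>i. 1 \<le> i \<and> i \<le> eta x \<omega> \<and> S x i n \<omega> = z}"
  have "Inf A \<le> enat n \<longleftrightarrow> (\<exists>m\<le>n. enat m \<in> A)"
  proof (cases "A = {}")
    case True
    then show ?thesis by (simp add: top_enat_def)
  next
    case False
    then have "Inf A \<in> A" using wellorder_InfI by blast
    show ?thesis
    proof
      assume "Inf A \<le> enat n"
      moreover from this obtain m where "Inf A = enat m" by (cases "Inf A") auto
      ultimately show "\<exists>m\<le>n. enat m \<in> A" using \<open>Inf A \<in> A\<close> by auto
    next
      assume "\<exists>m\<le>n. enat m \<in> A"
      then show "Inf A \<le> enat n" by (meson Inf_lower enat_ord_simps(1) order_trans)
    qed
  qed
  also have "\<dots> \<longleftrightarrow> (\<exists>m\<le>n. \<exists>i. 1 \<le> i \<and> i \<le> eta x \<omega> \<and> S x i m \<omega> = z)"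
    unfolding A_def by simp
  finally show ?thesis
    unfolding hit_time_def A_def[symmetric] by blast
qed

lemma passage_time_refl [simp]: "passage_time eta S \<omega> x x = 0"
proof -
  have "passage_time eta S \<omega> x x \<le> 0"
    unfolding passage_time_def
    by (intro Inf_lower CollectI exI[of _ "0 :: nat"] exI[of _ "\<lambda>_. x"]) simp
  then show ?thesis by simp
qed

text \<open>The one-hop chain from \<open>x\<close> to \<open>y\<close> makes the set of chain costs
  nonempty, even if its own cost is infinite. By well-ordering some chain attains the
  infimum.\<close>

lemma passage_time_chain:
  assumes "passage_time eta S \<omega> x y \<le> enat n"
  shows "\<exists>(k::nat) p. p 0 = x \<and> p k = y \<and>
    passage_time eta S \<omega> x y = (\<Sum>j=1..k. hit_time eta S \<omega> (p (j - 1)) (p j))"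
proof -
  define A where "A = {(\<Sum>j=1..k. hit_time eta S \<omega> (p (j - 1)) (p j)) | (k::nat) p. p 0 = x \<and> p k = y}"
  have "(\<Sum>j=1..(1::nat). hit_time eta S \<omega> (if j - 1 = 0 then x else y) (if j = 0 then x else y)) \<in> A"
    unfolding A_def
    by (rule CollectI, rule exI[of _ "1::nat"], rule exI[of _ "\<lambda>j. if j = 0 then x else y"]) simp
  then have "Inf A \<in> A" by (rule wellorder_InfI)
  then obtain k :: nat and p where "p 0 = x" "p k = y"
    "Inf A = (\<Sum>j=1..k. hit_time eta S \<omega> (p (j - 1)) (p j))"
    unfolding A_def by blast
  moreover have "passage_time eta S \<omega> x y = Inf A"
    by (simp add: passage_time_def A_def)
  ultimately show ?thesis by metis
qed

text \<open>Append \<open>z\<close> to an optimal chain ending in \<open>y\<close>. Every awakening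
  in the lower bound is obtained by such single extensions.\<close>

lemma passage_time_step:
  assumes xy: "passage_time eta S \<omega> x y \<le> enat m" and yz: "hit_time eta S \<omega> y z \<le> enat n"
  shows "passage_time eta S \<omega> x z \<le> enat (m + n)"
proof -
  obtain k :: nat and p where p: "p 0 = x" "p k = y"
    "passage_time eta S \<omega> x y = (\<Sum>j=1..k. hit_time eta S \<omega> (p (j - 1)) (p j))"
    using passage_time_chain[OF xy] by blast
  define q where "q = p(Suc k := z)"
  have "passage_time eta S \<omega> x z \<le> (\<Sum>j=1..Suc k. hit_time eta S \<omega> (q (j - 1)) (q j))"
    unfolding passage_time_def
    by (rule Inf_lower, rule CollectI, intro exI[of _ "Suc k"] exI[of _ q])
      (use p in \<open>auto simp: q_def\<close>)
  also have "\<dots> = (\<Sum>j=1..k. hit_time eta S \<omega> (p (j - 1)) (p j)) + hit_time eta S \<omega> y z"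
  proof -
    have "(\<Sum>j=1..k. hit_time eta S \<omega> (q (j - 1)) (q j)) = (\<Sum>j=1..k. hit_time eta S \<omega> (p (j - 1)) (p j))"
      by (intro sum.cong) (auto simp: q_def)
    then show ?thesis using p by (simp add: q_def)
  qed
  also have "\<dots> \<le> enat m + enat n"
    using xy yz p(3) by (intro add_mono) auto
  finally show ?thesis by simp
qed

text \<open>A hop costs at least its length because no walk is faster than one; the triangle
  inequality sums this along an optimal chain.\<close>

lemma l1_le_passage_time:
  assumes speed: "\<And>x i n. i \<ge> 1 \<Longrightarrow> l1 (S x i n \<omega> - x) \<le> n"
    and le: "passage_time eta S \<omega> x y \<le> enat n"
  shows "l1 (y - x) \<le> n"
proof -
  have hit: "enat (l1 (z - x)) \<le> hit_time eta S \<omega> x z" for x z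
    unfolding hit_time_def by (rule Inf_greatest) (use speed in auto)
  obtain k :: nat and p where p: "p 0 = x" "p k = y"
    "passage_time eta S \<omega> x y = (\<Sum>j=1..k. hit_time eta S \<omega> (p (j - 1)) (p j))"
    using passage_time_chain[OF le] by blast
  have "enat (l1 (p k - p 0)) \<le> (\<Sum>j=1..k. hit_time eta S \<omega> (p (j - 1)) (p j))" for k
  proof (induction k)
    case (Suc k)
    have "enat (l1 (p (Suc k) - p 0)) \<le> enat (l1 (p (Suc k) - p k)) + enat (l1 (p k - p 0))"
      using l1_triangle3 by simp
    also have "\<dots> \<le> hit_time eta S \<omega> (p k) (p (Suc k)) +
        (\<Sum>j=1..k. hit_time eta S \<omega> (p (j - 1)) (p j))"
      by (intro add_mono hit Suc)
    finally show ?case by (simp add: add.commute)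
  qed (simp add: zero_enat_def)
  from this[of k] p le have "enat (l1 (y - x)) \<le> enat n"
    by (metis order_trans)
  then show ?thesis by simp
qed

section \<open>Simple random walks\<close>

context prob_space
begin

lemma walk_measurable:
  assumes "simple_random_walk M x W"
  shows "W n \<in> M \<rightarrow>\<^sub>M count_space UNIV"
proof (induction n)
  case 0
  then show ?case using assms by (simp add: simple_random_walk_def)
next
  case (Suc n)
  have "(\<lambda>\<omega>. W (Suc n) \<omega> - W n \<omega>) \<in> M \<rightarrow>\<^sub>M count_space UNIV"
    using assms by (auto simp: simple_random_walk_def indep_vars_def)
  \<comment> \<open>The lattice is countable, so measurability of \<open>W n\<close> plus an
    increment follows by fixing the value \<open>i\<close> of \<open>W n\<close>.\<close>
  then have "(\<lambda>\<omega>. i + (W (Suc n) \<omega> - W n \<omega>)) \<in> M \<rightarrow>\<^sub>M count_space UNIV" for i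
    by (rule measurable_compose) simp
  from measurable_compose_countable[where f = "\<lambda>i \<omega>. i + (W (Suc n) \<omega> - W n \<omega>)", OF this Suc]
  show ?case by simp
qed

text \<open>The times form an arbitrary finite set because two cases are needed: the initial stretch
  of a geodesic and later blocks of time.\<close>

lemma walk_steps_prob:
  fixes W :: "nat \<Rightarrow> 'a \<Rightarrow> int ^ 'd"
  assumes W: "simple_random_walk M x W" and I: "finite I" and e: "\<And>i. i \<in> I \<Longrightarrow> e i \<in> unit_steps"
  shows "prob {\<omega> \<in> space M. \<forall>i\<in>I. W (Suc i) \<omega> - W i \<omega> = e i} = (1 / real (2 * CARD('d))) ^ card I"
proof (cases "I = {}")
  case True
  then show ?thesis by (simp add: prob_space)
next
  case False
  define X where "X i \<omega> = W (Suc i) \<omega> - W i \<omega>" for i \<omega>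
  have ind: "indep_vars (\<lambda>_. count_space UNIV) X UNIV"
    using W unfolding simple_random_walk_def X_def by blast
  have m: "X i \<in> M \<rightarrow>\<^sub>M count_space UNIV" for i
    using ind by (auto simp: indep_vars_def)
  have "{\<omega> \<in> space M. \<forall>i\<in>I. X i \<omega> = e i} = (\<Inter>i\<in>I. X i -` {e i} \<inter> space M)"
    using False by auto
  also have "prob \<dots> = (\<Prod>i\<in>I. prob (X i -` {e i} \<inter> space M))"
    by (rule indep_varsD[OF ind False I]) auto
  also have "\<dots> = (\<Prod>i\<in>I. 1 / real (2 * CARD('d)))"
  proof (rule prod.cong[OF refl])
    fix i assume i: "i \<in> I"
    have "prob (X i -` {e i} \<inter> space M) = measure (distr M (count_space UNIV) (X i)) {e i}"
      using m by (simp add: measure_distr)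
    also have "distr M (count_space UNIV) (X i) = measure_pmf (pmf_of_set unit_steps)"
      using W unfolding simple_random_walk_def X_def by blast
    also have "measure (measure_pmf (pmf_of_set unit_steps)) {e i} = 1 / real (2 * CARD('d))"
      using e[OF i] by (simp add: measure_pmf_single card_unit_steps)
    finally show "prob (X i -` {e i} \<inter> space M) = 1 / real (2 * CARD('d))" .
  qed
  finally show ?thesis by (simp add: X_def)
qed

lemma walk_AE:
  assumes W: "simple_random_walk M x W"
  shows "AE \<omega> in M. W 0 \<omega> = x \<and> (\<forall>n. W (Suc n) \<omega> - W n \<omega> \<in> unit_steps)"
proof -
  have "AE \<omega> in M. W (Suc n) \<omega> - W n \<omega> \<in> unit_steps" for n
  proof -
    have d: "distr M (count_space UNIV) (\<lambda>\<omega>. W (Suc n) \<omega> - W n \<omega>) = measure_pmf (pmf_of_set unit_steps)"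
      using W unfolding simple_random_walk_def by blast
    have m: "(\<lambda>\<omega>. W (Suc n) \<omega> - W n \<omega>) \<in> M \<rightarrow>\<^sub>M count_space UNIV"
      using W by (auto simp: simple_random_walk_def indep_vars_def)
    have "AE y in distr M (count_space UNIV) (\<lambda>\<omega>. W (Suc n) \<omega> - W n \<omega>). y \<in> unit_steps"
      unfolding d by (simp add: AE_measure_pmf_iff)
    then show ?thesis by (rule AE_distrD[OF m])
  qed
  moreover have "AE \<omega> in M. W 0 \<omega> = x"
    using W unfolding simple_random_walk_def by blast
  ultimately show ?thesis by (simp add: AE_all_countable)
qed

lemma walk_speed_AE:
  assumes "simple_random_walk M x W"
  shows "AE \<omega> in M. \<forall>n. l1 (W n \<omega> - x) \<le> n"
  using walk_AE[OF assms]
proof eventually_elim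
  case (elim \<omega>)
  show ?case
  proof
    fix n show "l1 (W n \<omega> - x) \<le> n"
    proof (induction n)
      case 0
      then show ?case using elim by simp
    next
      case (Suc n)
      have "l1 (W (Suc n) \<omega> - W n \<omega>) = 1" using elim l1_unit_step by blast
      then show ?case using Suc l1_triangle3[of "W (Suc n) \<omega>" x "W n \<omega>"] by simp
    qed
  qed
qed

text \<open>A single geodesic from \<open>x\<close> to \<open>y\<close> already has this
  probability, each of its steps being chosen with probability \<open>1 / (2d)\<close>.\<close>

lemma walk_point_prob:
  fixes W :: "nat \<Rightarrow> 'a \<Rightarrow> int ^ 'd"
  assumes W: "simple_random_walk M x W"
  shows "(1 / real (2 * CARD('d))) ^ l1 (y - x) \<le> prob {\<omega> \<in> space M. W (l1 (y - x)) \<omega> = y}"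
proof -
  define n where "n = l1 (y - x)"
  obtain e where e: "\<And>i. e i \<in> unit_steps" "(\<Sum>i<n. e i) = y - x"
    using geodesic_exists[of "y - x"] unfolding n_def by blast
  note [measurable] = walk_measurable[OF W]
  have "(1 / real (2 * CARD('d))) ^ n = prob {\<omega> \<in> space M. \<forall>i\<in>{..<n}. W (Suc i) \<omega> - W i \<omega> = e i}"
    using walk_steps_prob[OF W, of "{..<n}" e] e by simp
  also have "\<dots> \<le> prob {\<omega> \<in> space M. W n \<omega> = y}"
  proof (rule finite_measure_mono_AE)
    show "AE \<omega> in M. \<omega> \<in> {\<omega> \<in> space M. \<forall>i\<in>{..<n}. W (Suc i) \<omega> - W i \<omega> = e i} \<longrightarrow>
        \<omega> \<in> {\<omega> \<in> space M. W n \<omega> = y}"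
      using walk_AE[OF W]
    proof eventually_elim
      case (elim \<omega>)
      have "W n \<omega> - x = (\<Sum>i<n. W (Suc i) \<omega> - W i \<omega>)"
        using elim by (simp add: sum_lessThan_telescope[of "\<lambda>i. W i \<omega>"])
      then show ?case using e(2) by auto
    qed
    show "{\<omega> \<in> space M. W n \<omega> = y} \<in> events" by measurable
  qed
  finally show ?thesis by (simp add: n_def)
qed

text \<open>A long run of identical steps forces one of its endpoints far from the origin, and such
  runs occur in disjoint blocks of time independently.\<close>

lemma walk_unbounded_AE:
  fixes W :: "nat \<Rightarrow> 'a \<Rightarrow> int ^ 'd"
  assumes W: "simple_random_walk M x W"
  shows "AE \<omega> in M. \<forall>K. \<exists>n. K \<le> l1 (W n \<omega>)"
  unfolding AE_all_countable
proof
  fix K :: nat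
  \<comment> \<open>\<open>N\<close> equal steps displace the walk by norm \<open>2 * K\<close>, so
    the endpoints of such a run cannot both have norm below \<open>K\<close>.\<close>
  define N where "N = 2 * K"
  obtain u :: "int ^ 'd" where u: "u = axis undefined 1" by blast
  have us: "u \<in> unit_steps" by (auto simp: u unit_steps_def)
  define I where "I j = {j * N..<Suc j * N}" for j
  define X where "X i \<omega> = W (Suc i) \<omega> - W i \<omega>" for i \<omega>
  define p where "p = (1 / real (2 * CARD('d))) ^ N"
  note [measurable] = walk_measurable[OF W]
  have ind: "indep_vars (\<lambda>_. count_space UNIV) X UNIV"
    using W unfolding simple_random_walk_def X_def by blast
  have mX [measurable]: "X i \<in> M \<rightarrow>\<^sub>M count_space UNIV" for i
    using ind by (auto simp: indep_vars_def)
  have disj: "disjoint_family_on I UNIV"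
    unfolding disjoint_family_on_def
  proof (intro ballI impI)
    fix i j :: nat assume "i \<noteq> j"
    then have "Suc i * N \<le> j * N \<or> Suc j * N \<le> i * N"
      by (metis Suc_leI linorder_neqE_nat mult_le_mono1)
    then show "I i \<inter> I j = {}" unfolding I_def by fastforce
  qed
  have "indep_vars (\<lambda>j. PiM (I j) (\<lambda>_. count_space UNIV)) (\<lambda>j \<omega>. restrict (\<lambda>i. X i \<omega>) (I j)) UNIV"
    by (rule indep_vars_restrict[OF ind _ disj]) auto
  then have "indep_events (\<lambda>j. {\<omega> \<in> space M. \<exists>i\<in>I j. restrict (\<lambda>i. X i \<omega>) (I j) i \<noteq> u}) UNIV"
  proof (rule indep_eventsI_indep_vars)
    fix j
    show "{f \<in> space (PiM (I j) (\<lambda>_. count_space UNIV)). \<exists>i\<in>I j. f i \<noteq> u}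
        \<in> sets (PiM (I j) (\<lambda>_. count_space UNIV))"
      by (auto simp: I_def intro!: sets.sets_Collect_finite_Ex)
  qed
  moreover define B where "B j = {\<omega> \<in> space M. \<exists>i\<in>I j. X i \<omega> \<noteq> u}" for j
  moreover have "(\<lambda>j. {\<omega> \<in> space M. \<exists>i\<in>I j. restrict (\<lambda>i. X i \<omega>) (I j) i \<noteq> u}) = B"
    by (auto simp: B_def fun_eq_iff)
  ultimately have indB: "indep_events B UNIV" by simp
  then have evB: "B j \<in> events" for j by (auto simp: indep_events_def)
  have probB: "prob (B j) = 1 - p" for j
  proof -
    have "prob (B j) = 1 - prob (space M - B j)"
      using evB prob_compl by simp
    also have "space M - B j = {\<omega> \<in> space M. \<forall>i\<in>I j. W (Suc i) \<omega> - W i \<omega> = u}"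
      by (auto simp: B_def X_def)
    also have "prob \<dots> = p"
      using walk_steps_prob[OF W, of "I j" "\<lambda>_. u"] us by (simp add: I_def p_def)
    finally show ?thesis .
  qed
  define A where "A = {\<omega> \<in> space M. \<forall>n. l1 (W n \<omega>) < K}"
  have evA: "A \<in> events" unfolding A_def by measurable
  have sub: "A \<subseteq> B j" for j
  proof
    fix \<omega> assume w: "\<omega> \<in> A"
    show "\<omega> \<in> B j"
    proof (rule ccontr)
      assume "\<omega> \<notin> B j"
      then have u': "X i \<omega> = u" if "i \<in> I j" for i using w that by (auto simp: B_def A_def)
      have "W (j * N + n) \<omega> - W (j * N) \<omega> = axis undefined (int n)" if "n \<le> N" for n
        using that
      proof (induction n)
        case (Suc n)
        have "W (j * N + Suc n) \<omega> - W (j * N) \<omega> = X (j * N + n) \<omega> + (W (j * N + n) \<omega> - W (j * N) \<omega>)"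
          by (simp add: X_def)
        also have "X (j * N + n) \<omega> = u" using Suc(2) by (intro u') (simp add: I_def)
        finally show ?case using Suc by (simp add: u vec_eq_iff axis_def)
      qed (simp add: vec_eq_iff axis_def)
      from this[of N] have "N \<le> l1 (W (j * N + N) \<omega>) + l1 (W (j * N) \<omega>)"
        using l1_triangle_diff[of "W (j * N + N) \<omega>" "W (j * N) \<omega>"] by (simp add: l1_axis)
      moreover have "l1 (W (j * N + N) \<omega>) < K" "l1 (W (j * N) \<omega>) < K"
        using w by (auto simp: A_def)
      ultimately show False by (simp add: N_def)
    qed
  qed
  have p: "0 < p" by (simp add: p_def)
  \<comment> \<open>Staying below norm \<open>K\<close> forces a deviating step in every block; the
    first \<open>Suc J\<close> blocks do so independently, each with probability
    \<open>1 - p\<close>.\<close>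
  have le: "prob A \<le> (1 - p) ^ Suc J" for J
  proof -
    have "prob A \<le> prob (\<Inter>j\<in>{..J}. B j)"
      using sub evB by (intro finite_measure_mono) (auto intro!: sets.finite_INT)
    also have "\<dots> = (\<Prod>j\<in>{..J}. prob (B j))"
      using indB[unfolded indep_events_def, THEN conjunct2, rule_format, of "{..J}"] by simp
    finally show ?thesis by (simp add: probB)
  qed
  have "0 \<le> 1 - p" using probB[of 0] measure_nonneg[of M "B 0"] by linarith
  then have "(\<lambda>J. (1 - p) ^ Suc J) \<longlonglongrightarrow> 0"
    using p by (intro LIMSEQ_Suc LIMSEQ_power_zero) auto
  then have "prob A \<le> 0" using le by (intro LIMSEQ_le_const) auto
  then have "prob A = 0" by (simp add: measure_le_0_iff)
  then have "AE \<omega> in M. \<omega> \<notin> A" using evA prob_eq_0 by blast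
  then show "AE \<omega> in M. \<exists>n. K \<le> l1 (W n \<omega>)"
    using AE_space by eventually_elim (auto simp: A_def not_less)
qed

end

section \<open>Number of sites visited by an unbounded nearest-neighbour path\<close>

text \<open>Discrete intermediate value theorem: the first time at which \<open>f\<close> is at
  least \<open>m\<close> cannot overshoot, since \<open>f\<close> grows by at most one per
  step.\<close>

lemma discrete_hits_levels:
  fixes f :: "nat \<Rightarrow> nat"
  assumes "f 0 = 0" "\<And>n. f (Suc n) \<le> Suc (f n)" "m \<le> f n"
  shows "\<exists>n. f n = m"
proof -
  define k where "k = (LEAST n. m \<le> f n)"
  have k: "m \<le> f k" unfolding k_def by (rule LeastI[of _ n]) fact
  have "f k \<le> m"
  proof (cases k)
    case (Suc i)
    then have "\<not> m \<le> f i" unfolding k_def by (metis not_less_Least lessI)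
    then show ?thesis using assms(2)[of i] Suc by simp
  qed (simp add: assms)
  then show ?thesis using k by (intro exI[of _ k]) simp
qed

text \<open>The norm along the path takes every value below \<open>r\<close>, and sites of different
  norms are different.\<close>

lemma card_visited_ge:
  fixes w :: "nat \<Rightarrow> int ^ 'd"
  assumes "w 0 = 0" "\<And>n. w (Suc n) - w n \<in> unit_steps" "\<And>K. \<exists>n. K \<le> l1 (w n)"
    and "finite A" and A: "\<And>n. l1 (w n) < r \<Longrightarrow> w n \<in> A"
  shows "r \<le> card A"
proof -
  have "l1 (w (Suc n)) \<le> Suc (l1 (w n))" for n
    using l1_triangle[of "w (Suc n) - w n" "w n"] l1_unit_step[OF assms(2)[of n]] by simp
  then have lev: "\<exists>n. l1 (w n) = m" for m
    using assms(1,3) discrete_hits_levels[of "\<lambda>n. l1 (w n)" m] by fastforce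
  have "{..<r} \<subseteq> l1 ` A"
  proof
    fix m assume "m \<in> {..<r}"
    with lev[of m] A show "m \<in> l1 ` A" by force
  qed
  then have "card {..<r} \<le> card (l1 ` A)" using assms(4) by (intro card_mono) auto
  also have "\<dots> \<le> card A" by (rule card_image_le) fact
  finally show ?thesis by simp
qed

section \<open>Independence estimates\<close>

lemma finite_l1_ball: "finite {x :: int ^ 'd. l1 x < r}"
proof (rule finite_subset)
  show "{x :: int ^ 'd. l1 x < r} \<subseteq> {x. \<forall>k. x $ k \<in> {- int r..int r}}"
  proof clarify
    fix x :: "int ^ 'd" and k
    assume "l1 x < r"
    then show "x $ k \<in> {- int r..int r}" using component_le_l1[of x k] by auto
  qed
qed (rule finite_vec_box, simp)

text \<open>The truncation is in space only; the path may take arbitrarily long. This keeps the set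
  finite without limiting how many norms are reached.\<close>

definition visited :: "(nat \<Rightarrow> int ^ 'd) \<Rightarrow> nat \<Rightarrow> (int ^ 'd) set" where
  "visited w r = {x. l1 x < r \<and> (\<exists>n. w n = x)}"

context frog_model
begin

lemma eta_measurable [measurable]: "eta x \<in> M \<rightarrow>\<^sub>M count_space UNIV"
  using eta_indep by (auto simp: indep_vars_def)

lemma walks_measurable:
  assumes "i \<ge> 1"
  shows "S x i n \<in> M \<rightarrow>\<^sub>M count_space UNIV"
  using walk_measurable[OF walk[OF assms]] .

lemma eta_all_less_prob:
  assumes "finite A"
  shows "prob {\<omega> \<in> space M. \<forall>x\<in>A. eta x \<omega> < N} = (1 - measure_pmf.prob law {k. N \<le> k}) ^ card A"
proof (cases "A = {}")
  case True
  then show ?thesis by (simp add: prob_space)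
next
  case False
  have "{\<omega> \<in> space M. \<forall>x\<in>A. eta x \<omega> < N} = (\<Inter>x\<in>A. eta x -` {..<N} \<inter> space M)"
    using False by auto
  also have "prob \<dots> = (\<Prod>x\<in>A. prob (eta x -` {..<N} \<inter> space M))"
    by (rule indep_varsD[OF eta_indep False assms]) auto
  also have "\<dots> = (\<Prod>x\<in>A. 1 - measure_pmf.prob law {k. N \<le> k})"
  proof (rule prod.cong[OF refl])
    fix x
    have "prob (eta x -` {..<N} \<inter> space M) = measure (distr M (count_space UNIV) (eta x)) {..<N}"
      by (simp add: measure_distr)
    also have "\<dots> = measure_pmf.prob law {..<N}" by (simp add: eta_law)
    also have "\<dots> = measure_pmf.prob law (UNIV - {k. N \<le> k})"
      by (rule arg_cong[where f = "measure_pmf.prob law"]) auto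
    also have "\<dots> = 1 - measure_pmf.prob law {k. N \<le> k}"
      using measure_pmf.prob_compl[of "{k. N \<le> k}" law] by simp
    finally show "prob (eta x -` {..<N} \<inter> space M) = 1 - measure_pmf.prob law {k. N \<le> k}" .
  qed
  finally show ?thesis by simp
qed

text \<open>Each walk is tested only at the earliest possible time \<open>l1 (y - x)\<close>, where
  \<open>walk_point_prob\<close> bounds its chance from below; distinct walks are
  independent.\<close>

lemma all_walks_miss_prob:
  "prob {\<omega> \<in> space M. \<forall>i\<in>{1..N}. S x i (l1 (y - x)) \<omega> \<noteq> y}
     \<le> (1 - (1 / real (2 * CARD('d))) ^ l1 (y - x)) ^ N"
proof (cases "N = 0")
  case True
  then show ?thesis by simp
next
  case False
  define n where "n = l1 (y - x)"
  define J where "J = {x} \<times> {1..N}"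
  define X where "X = (\<lambda>(x, i) \<omega>. \<lambda>n. S x i n \<omega>)"
  have ind: "indep_vars (\<lambda>_. PiM UNIV (\<lambda>_::nat. count_space UNIV)) X (UNIV \<times> {1..})"
    using walks_indep by (simp add: X_def)
  have m: "{f. f n \<noteq> y} \<in> sets (PiM UNIV (\<lambda>_::nat. count_space UNIV))"
  proof -
    have "(\<lambda>f. f n) -` (- {y}) \<inter> space (PiM UNIV (\<lambda>_::nat. count_space UNIV))
        \<in> sets (PiM UNIV (\<lambda>_::nat. count_space UNIV))"
      by (rule measurable_sets[OF measurable_component_singleton]) auto
    moreover have "(\<lambda>f. f n) -` (- {y}) \<inter> space (PiM UNIV (\<lambda>_::nat. count_space UNIV)) = {f. f n \<noteq> y}"
      by (auto simp: space_PiM)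
    ultimately show ?thesis by simp
  qed
  have "{\<omega> \<in> space M. \<forall>i\<in>{1..N}. S x i n \<omega> \<noteq> y} = (\<Inter>j\<in>J. X j -` {f. f n \<noteq> y} \<inter> space M)"
    using False by (fastforce simp: J_def X_def)
  also have "prob \<dots> = (\<Prod>j\<in>J. prob (X j -` {f. f n \<noteq> y} \<inter> space M))"
    by (rule indep_varsD[OF ind]) (use False m in \<open>auto simp: J_def\<close>)
  also have "\<dots> \<le> (\<Prod>j\<in>J. 1 - (1 / real (2 * CARD('d))) ^ n)"
  proof (rule prod_mono, rule conjI)
    fix j assume "j \<in> J"
    then obtain i where i: "j = (x, i)" "i \<ge> 1" by (auto simp: J_def)
    have ev: "{\<omega> \<in> space M. S x i n \<omega> = y} \<in> events"
      using walks_measurable[OF i(2), of x n] by measurable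
    have "X j -` {f. f n \<noteq> y} \<inter> space M = space M - {\<omega> \<in> space M. S x i n \<omega> = y}"
      by (auto simp: X_def i)
    then have "prob (X j -` {f. f n \<noteq> y} \<inter> space M) = 1 - prob {\<omega> \<in> space M. S x i n \<omega> = y}"
      using prob_compl[OF ev] by simp
    also have "\<dots> \<le> 1 - (1 / real (2 * CARD('d))) ^ n"
      using walk_point_prob[OF walk[OF i(2)], of y x] by (simp add: n_def)
    finally show "prob (X j -` {f. f n \<noteq> y} \<inter> space M) \<le> 1 - (1 / real (2 * CARD('d))) ^ n" .
  qed simp
  also have "\<dots> = (1 - (1 / real (2 * CARD('d))) ^ n) ^ N" by (simp add: J_def)
  finally show ?thesis by (simp add: n_def)
qed

text \<open>The set of sites visited by the first walk is independent of the initial configuration, so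
  one may condition on it.\<close>

lemma visited_all_less:
  fixes r N :: nat
  defines "B \<equiv> {\<omega> \<in> space M. r \<le> card (visited (\<lambda>n. S 0 1 n \<omega>) r) \<and>
                 (\<forall>x\<in>visited (\<lambda>n. S 0 1 n \<omega>) r. eta x \<omega> < N)}"
  shows "B \<in> events" and "prob B \<le> (1 - measure_pmf.prob law {k. N \<le> k}) ^ r"
proof -
  let ?V = "\<lambda>\<omega>. visited (\<lambda>n. S 0 1 n \<omega>) r"
  let ?P = "PiM (UNIV \<times> {1::nat..}) (\<lambda>_. PiM UNIV (\<lambda>_::nat. count_space UNIV)) ::
    ((int ^ 'd) \<times> nat \<Rightarrow> nat \<Rightarrow> int ^ 'd) measure"
  define F where "F = (\<lambda>\<omega>. \<lambda>(x, i)\<in>UNIV \<times> {1..}. \<lambda>n. S x i n \<omega>)"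
  define q where "q = 1 - measure_pmf.prob law {k. N \<le> k}"
  have q: "0 \<le> q" "q \<le> 1" by (simp_all add: q_def)
  \<comment> \<open>The possible values of the visited set on \<open>B\<close>: finitely many, since
    all are subsets of one ball.\<close>
  define \<A> where "\<A> = {A. A \<subseteq> {x :: int ^ 'd. l1 x < r} \<and> r \<le> card A}"
  have fin\<A>: "finite \<A>"
    unfolding \<A>_def by (rule finite_subset[of _ "Pow {x. l1 x < r}"]) (auto simp: finite_l1_ball)
  have finA: "finite A" if "A \<in> \<A>" for A
    using that finite_subset[OF _ finite_l1_ball] unfolding \<A>_def by blast
  define C where "C A = {\<omega> \<in> space M. ?V \<omega> = A}" for A
  define D where "D A = {\<omega> \<in> space M. \<forall>x\<in>A. eta x \<omega> < N}" for A
  have g: "(\<lambda>g. g (0, 1) n) \<in> ?P \<rightarrow>\<^sub>M count_space UNIV" for n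
    by (rule measurable_compose[where f = "\<lambda>g. g (0, 1)" and g = "\<lambda>f. f n"
          and N = "PiM UNIV (\<lambda>_. count_space UNIV)"];
        rule measurable_component_singleton; simp)
  \<comment> \<open>Whether the visited set equals \<open>A\<close> depends on the first walk from
    the origin alone and is tested at the finitely many points of the ball.\<close>
  have Cs: "C A \<in> sets (vimage_algebra (space M) F ?P)" if A: "A \<in> \<A>" for A
  proof -
    let ?G = "{g \<in> space ?P. \<forall>x\<in>{x. l1 x < r}. (\<exists>n. g (0, 1) n = x) \<longleftrightarrow> x \<in> A}"
    note g [measurable]
    have "?G \<in> sets ?P"
      by (rule sets.sets_Collect_finite_All[OF _ finite_l1_ball]) measurable
    then have "F -` ?G \<inter> space M \<in> sets (vimage_algebra (space M) F ?P)"
      by (rule in_vimage_algebra)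
    also have "F -` ?G \<inter> space M = C A"
      using A by (auto simp: C_def F_def visited_def space_PiM PiE_def extensional_def \<A>_def)
    finally show ?thesis .
  qed
  have Ds: "D A \<in> sets (vimage_algebra (space M) (\<lambda>\<omega> x. eta x \<omega>) (PiM UNIV (\<lambda>_. count_space UNIV)))"
    if A: "A \<in> \<A>" for A
  proof -
    let ?G = "{h \<in> space (PiM UNIV (\<lambda>_ :: int ^ 'd. count_space (UNIV :: nat set))). \<forall>x\<in>A. h x < N}"
    have "?G \<in> sets (PiM UNIV (\<lambda>_. count_space UNIV))"
      using finA[OF A] by measurable
    then have "(\<lambda>\<omega> x. eta x \<omega>) -` ?G \<inter> space M
        \<in> sets (vimage_algebra (space M) (\<lambda>\<omega> x. eta x \<omega>) (PiM UNIV (\<lambda>_. count_space UNIV)))"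
      by (rule in_vimage_algebra)
    also have "(\<lambda>\<omega> x. eta x \<omega>) -` ?G \<inter> space M = D A"
      by (auto simp: D_def space_PiM)
    finally show ?thesis .
  qed
  have ind: "prob (D A \<inter> C A) = prob (D A) * prob (C A)" if A: "A \<in> \<A>" for A
    by (rule indep_setD[OF eta_walks_indep Ds[OF A]]) (use Cs[OF A] in \<open>simp add: F_def\<close>)
  have Ce: "C A \<in> events" and De: "D A \<in> events" if A: "A \<in> \<A>" for A
    using eta_walks_indep Cs[OF A] Ds[OF A] unfolding indep_sets2_eq F_def by blast+
  have vis: "?V \<omega> \<subseteq> {x. l1 x < r}" for \<omega> by (auto simp: visited_def)
  \<comment> \<open>Splitting by the value \<open>A\<close> of the visited set turns the random
    index set into a fixed one, so \<open>D A\<close> depends only on \<open>eta\<close> and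
    \<open>C A\<close> only on the walks.\<close>
  have B: "B = (\<Union>A\<in>\<A>. D A \<inter> C A)"
    using vis by (auto simp: B_def C_def D_def \<A>_def)
  show "B \<in> events"
    unfolding B using fin\<A> Ce De by (intro sets.finite_UN sets.Int) auto
  have "prob B \<le> (\<Sum>A\<in>\<A>. prob (D A \<inter> C A))"
    unfolding B using fin\<A> Ce De by (intro finite_measure_subadditive_finite) auto
  also have "\<dots> \<le> (\<Sum>A\<in>\<A>. q ^ r * prob (C A))"
  proof (rule sum_mono)
    fix A assume A: "A \<in> \<A>"
    have "prob (D A) = q ^ card A"
      unfolding D_def q_def by (rule eta_all_less_prob[OF finA[OF A]])
    also have "\<dots> \<le> q ^ r" using A q by (intro power_decreasing) (auto simp: \<A>_def)
    finally show "prob (D A \<inter> C A) \<le> q ^ r * prob (C A)"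
      unfolding ind[OF A] by (intro mult_right_mono) auto
  qed
  \<comment> \<open>The events \<open>C A\<close> are disjoint, so their probabilities add up to at
    most one.\<close>
  also have "\<dots> = q ^ r * prob (\<Union>A\<in>\<A>. C A)"
    unfolding sum_distrib_left[symmetric] using fin\<A> Ce
    by (subst finite_measure_finite_Union) (auto simp: disjoint_family_on_def C_def)
  also have "\<dots> \<le> q ^ r * 1" using q by (intro mult_left_mono) auto
  finally show "prob B \<le> (1 - measure_pmf.prob law {k. N \<le> k}) ^ r" by (simp add: q_def)
qed

end

section \<open>The dyadic chain of rich sites\<close>

definition sup_box :: "nat \<Rightarrow> (int ^ 'd) set" where
  "sup_box r = {x. \<forall>k. x $ k \<in> {- int r..int r}}"

lemma finite_sup_box: "finite (sup_box r)"
  unfolding sup_box_def by (rule finite_vec_box) simp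

lemma card_sup_box: "card (sup_box r :: (int ^ 'd) set) = (2 * r + 1) ^ CARD('d)"
proof -
  have "card {- int r..int r} = 2 * r + 1" by simp
  then show ?thesis unfolding sup_box_def by (subst card_vec_box) simp_all
qed

lemma mem_sup_box_iff: "x \<in> sup_box r \<longleftrightarrow> (\<forall>k. \<bar>x $ k\<bar> \<le> int r)"
proof -
  have "v \<in> {- int r..int r} \<longleftrightarrow> \<bar>v\<bar> \<le> int r" for v by auto
  then show ?thesis by (simp add: sup_box_def)
qed

lemma sup_box_mono: "x \<in> sup_box r \<Longrightarrow> r \<le> s \<Longrightarrow> x \<in> sup_box s"
  unfolding mem_sup_box_iff by (meson order_trans zle_int)

lemma l1_le_imp_mem_sup_box: "l1 x \<le> r \<Longrightarrow> x \<in> sup_box r"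
  unfolding mem_sup_box_iff
proof
  fix k assume "l1 x \<le> r"
  then show "\<bar>x $ k\<bar> \<le> int r" using component_le_l1[of x k] by linarith
qed

text \<open>Sites that are rich at the levels \<open>m\<^sub>0, 2 m\<^sub>0, 4 m\<^sub>0, \<dots>\<close> are reached one from another; the
  dyadic growth makes the total detour comparable to the last step.\<close>

lemma dyadic_chain:
  fixes eta :: "int ^ 'd \<Rightarrow> 'w \<Rightarrow> nat" and S :: "int ^ 'd \<Rightarrow> nat \<Rightarrow> nat \<Rightarrow> 'w \<Rightarrow> int ^ 'd"
    and R :: "nat \<Rightarrow> nat"
  assumes m0: "m\<^sub>0 \<ge> 1" and L: "CARD('d) \<le> L"
    and fast: "\<forall>m\<ge>m\<^sub>0. \<forall>x\<in>sup_box (2 * m ^ CARD('d)). R m \<le> eta x \<omega> \<longrightarrow>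
        (\<forall>y. l1 (y - x) \<le> L * m \<longrightarrow> hit_time eta S \<omega> x y \<le> enat (l1 (y - x)))"
    and near: "\<forall>m\<ge>m\<^sub>0. \<forall>x\<in>sup_box (2 * m ^ CARD('d)).
        \<exists>z. (\<forall>k. z $ k - x $ k \<in> {0..<int m}) \<and> R (2 * m) \<le> eta z \<omega>"
    and x0: "x\<^sub>0 \<in> sup_box (m\<^sub>0 ^ CARD('d))" "R m\<^sub>0 \<le> eta x\<^sub>0 \<omega>"
        "passage_time eta S \<omega> 0 x\<^sub>0 \<le> enat T\<^sub>0"
  shows "\<exists>x \<in> sup_box (m\<^sub>0 ^ CARD('d) + 2 ^ j * m\<^sub>0). R (2 ^ j * m\<^sub>0) \<le> eta x \<omega> \<and>
      passage_time eta S \<omega> 0 x \<le> enat (T\<^sub>0 + CARD('d) * (2 ^ j * m\<^sub>0))"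
proof (induction j)
  case 0
  have "x\<^sub>0 \<in> sup_box (m\<^sub>0 ^ CARD('d) + 2 ^ 0 * m\<^sub>0)"
    by (rule sup_box_mono[OF x0(1)]) simp
  moreover have "passage_time eta S \<omega> 0 x\<^sub>0 \<le> enat (T\<^sub>0 + CARD('d) * (2 ^ 0 * m\<^sub>0))"
    by (rule order_trans[OF x0(3)]) simp
  ultimately show ?case using x0(2) by (intro bexI[of _ x\<^sub>0]) simp_all
next
  case (Suc j)
  define m where "m = 2 ^ j * m\<^sub>0"
  have m: "m \<ge> m\<^sub>0" by (simp add: m_def)
  from Suc obtain x where x: "x \<in> sup_box (m\<^sub>0 ^ CARD('d) + m)" "R m \<le> eta x \<omega>"
      "passage_time eta S \<omega> 0 x \<le> enat (T\<^sub>0 + CARD('d) * m)"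
    unfolding m_def by blast
  \<comment> \<open>Both summands of the box radius are at most \<open>m ^ d\<close>; this is why
    \<open>fast\<close> and \<open>near\<close> are assumed on boxes of radius
    \<open>2 * m ^ d\<close>.\<close>
  have "m\<^sub>0 ^ CARD('d) \<le> m ^ CARD('d)" using m by (rule power_mono) simp
  moreover have "m \<le> m ^ CARD('d)" using m m0 by (intro self_le_power) auto
  ultimately have box: "x \<in> sup_box (2 * m ^ CARD('d))"
    by (intro sup_box_mono[OF x(1)]) linarith
  from near m box obtain z where z: "\<And>k. z $ k - x $ k \<in> {0..<int m}" "R (2 * m) \<le> eta z \<omega>"
    by blast
  have zx: "l1 (z - x) \<le> CARD('d) * m"
    by (rule l1_le_card_mult) (use z(1) in \<open>auto simp: less_imp_le\<close>)
  also have "\<dots> \<le> L * m" using L by simp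
  finally have "hit_time eta S \<omega> x z \<le> enat (l1 (z - x))" by (rule fast[rule_format, OF m box x(2)])
  from passage_time_step[OF x(3) this]
  have "passage_time eta S \<omega> 0 z \<le> enat (T\<^sub>0 + CARD('d) * m + l1 (z - x))" .
  \<comment> \<open>The \<open>d * m\<close> already spent and the at most \<open>d * m\<close> of
    the new hop make \<open>d\<close> times the doubled level, which closes the induction.\<close>
  also have "\<dots> \<le> enat (T\<^sub>0 + CARD('d) * (2 ^ Suc j * m\<^sub>0))"
    using zx by (simp add: m_def algebra_simps)
  finally have "passage_time eta S \<omega> 0 z \<le> enat (T\<^sub>0 + CARD('d) * (2 ^ Suc j * m\<^sub>0))" .
  moreover have "z \<in> sup_box (m\<^sub>0 ^ CARD('d) + 2 ^ Suc j * m\<^sub>0)"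
    unfolding mem_sup_box_iff
  proof
    fix k
    have "\<bar>x $ k\<bar> \<le> int (m\<^sub>0 ^ CARD('d) + m)" using x(1) mem_sup_box_iff by blast
    moreover have "\<bar>z $ k - x $ k\<bar> \<le> int m" using z(1)[of k] by auto
    ultimately have "\<bar>z $ k\<bar> \<le> int (m\<^sub>0 ^ CARD('d) + m) + int m" by linarith
    also have "\<dots> = int (m\<^sub>0 ^ CARD('d) + 2 ^ Suc j * m\<^sub>0)" by (simp add: m_def)
    finally show "\<bar>z $ k\<bar> \<le> int (m\<^sub>0 ^ CARD('d) + 2 ^ Suc j * m\<^sub>0)" .
  qed
  moreover have "R (2 ^ Suc j * m\<^sub>0) \<le> eta z \<omega>" using z(2) by (simp add: m_def mult.assoc)
  ultimately show ?case by blast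
qed

text \<open>For the least \<open>j\<close> with \<open>n \<le> 2 ^ j * a\<close>, halving falls
  below \<open>n\<close>.\<close>

lemma dyadic_scale:
  fixes a n :: nat
  assumes "1 \<le> a" "a \<le> n"
  shows "\<exists>j. n \<le> 2 ^ j * a \<and> 2 ^ j * a \<le> 2 * n"
proof -
  define j where "j = (LEAST j. n \<le> 2 ^ j * a)"
  have "n \<le> 2 ^ n * a" using less_exp[of n] assms(1)
    by (metis less_imp_le mult.right_neutral mult_le_mono)
  then have j: "n \<le> 2 ^ j * a" unfolding j_def by (rule LeastI)
  have "2 ^ j * a \<le> 2 * n"
  proof (cases j)
    case (Suc i)
    then have "\<not> n \<le> 2 ^ i * a" unfolding j_def by (metis not_less_Least lessI)
    then show ?thesis using Suc by simp
  qed (use assms in simp)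
  then show ?thesis using j by blast
qed

text \<open>The chain is followed up to a level \<open>m\<close> with
  \<open>n \<le> L * m \<le> 2 * n\<close>, and from the site \<open>x\<close> found there a
  geodesic leads to \<open>y\<close>. The time of the chain and the distance of \<open>x\<close>
  from the origin each contribute \<open>d * m\<close>, in total at most
  \<open>4 * d * n / L\<close>; assumption \<open>y\<close> is this budget multiplied by
  \<open>L\<close> to remain in the naturals.\<close>

lemma awakened_at_full_speed:
  fixes eta :: "int ^ 'd \<Rightarrow> 'w \<Rightarrow> nat" and S :: "int ^ 'd \<Rightarrow> nat \<Rightarrow> nat \<Rightarrow> 'w \<Rightarrow> int ^ 'd"
    and R :: "nat \<Rightarrow> nat"
  assumes m0: "m\<^sub>0 \<ge> 1" and L: "CARD('d) \<le> L"
    and fast: "\<forall>m\<ge>m\<^sub>0. \<forall>x\<in>sup_box (2 * m ^ CARD('d)). R m \<le> eta x \<omega> \<longrightarrow>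
        (\<forall>y. l1 (y - x) \<le> L * m \<longrightarrow> hit_time eta S \<omega> x y \<le> enat (l1 (y - x)))"
    and near: "\<forall>m\<ge>m\<^sub>0. \<forall>x\<in>sup_box (2 * m ^ CARD('d)).
        \<exists>z. (\<forall>k. z $ k - x $ k \<in> {0..<int m}) \<and> R (2 * m) \<le> eta z \<omega>"
    and x0: "x\<^sub>0 \<in> sup_box (m\<^sub>0 ^ CARD('d))" "R m\<^sub>0 \<le> eta x\<^sub>0 \<omega>"
        "passage_time eta S \<omega> 0 x\<^sub>0 \<le> enat T\<^sub>0"
    and n: "L * m\<^sub>0 \<le> n"
    and y: "L * (l1 y + T\<^sub>0 + CARD('d) * m\<^sub>0 ^ CARD('d)) + 4 * CARD('d) * n \<le> L * n"
  shows "y \<in> awakened eta S \<omega> n"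
proof -
  have "0 < CARD('d)" by simp
  then have L1: "1 \<le> L" using L by linarith
  then have "1 \<le> L * m\<^sub>0" using m0 by simp
  \<comment> \<open>The scale is matched to the reach \<open>L * m\<close> of a level, not to the
    level itself.\<close>
  then obtain j where j: "n \<le> 2 ^ j * (L * m\<^sub>0)" "2 ^ j * (L * m\<^sub>0) \<le> 2 * n"
    using dyadic_scale n by blast
  define m where "m = 2 ^ j * m\<^sub>0"
  have m: "m\<^sub>0 \<le> m" by (simp add: m_def)
  have Lm: "n \<le> L * m" "L * m \<le> 2 * n" using j by (simp_all add: m_def mult.left_commute)
  obtain x where x: "x \<in> sup_box (m\<^sub>0 ^ CARD('d) + m)" "R m \<le> eta x \<omega>"
      "passage_time eta S \<omega> 0 x \<le> enat (T\<^sub>0 + CARD('d) * m)"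
    using dyadic_chain[OF m0 L fast near x0]
    unfolding m_def by blast
  have "m\<^sub>0 ^ CARD('d) \<le> m ^ CARD('d)" using m by (rule power_mono) simp
  moreover have "m \<le> m ^ CARD('d)" using m m0 by (intro self_le_power) auto
  ultimately have box: "x \<in> sup_box (2 * m ^ CARD('d))"
    by (intro sup_box_mono[OF x(1)]) linarith
  have "l1 x \<le> CARD('d) * (m\<^sub>0 ^ CARD('d) + m)"
    using x(1) by (intro l1_le_card_mult) (simp add: mem_sup_box_iff)
  then have yx: "l1 (y - x) \<le> l1 y + CARD('d) * (m\<^sub>0 ^ CARD('d) + m)"
    using l1_triangle_diff[of y x] by linarith
  have "L * (l1 y + T\<^sub>0 + CARD('d) * m\<^sub>0 ^ CARD('d) + 2 * CARD('d) * m) =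
      L * (l1 y + T\<^sub>0 + CARD('d) * m\<^sub>0 ^ CARD('d)) + 2 * CARD('d) * (L * m)"
    by (simp add: algebra_simps)
  also have "\<dots> \<le> L * (l1 y + T\<^sub>0 + CARD('d) * m\<^sub>0 ^ CARD('d)) + 2 * CARD('d) * (2 * n)"
    using Lm(2) by (intro add_mono mult_le_mono2 order_refl)
  also have "\<dots> \<le> L * n" using y by simp
  finally have tot: "l1 y + T\<^sub>0 + CARD('d) * m\<^sub>0 ^ CARD('d) + 2 * CARD('d) * m \<le> n"
    using L1 by simp
  have "l1 (y - x) \<le> L * m" using tot yx Lm(1) by (simp add: algebra_simps)
  then have "hit_time eta S \<omega> x y \<le> enat (l1 (y - x))" by (rule fast[rule_format, OF m box x(2)])
  from passage_time_step[OF x(3) this]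
  have "passage_time eta S \<omega> 0 y \<le> enat (T\<^sub>0 + CARD('d) * m + l1 (y - x))" .
  also have "\<dots> \<le> enat n" using tot yx by (simp add: algebra_simps)
  finally show ?thesis by (simp add: awakened_def)
qed

section \<open>Borel-Cantelli for stretched exponential bounds\<close>

lemma summable_power_times_stretched_exp:
  fixes b c :: real
  assumes "b > 0" "c > 0"
  shows "summable (\<lambda>m. real m ^ p * exp (- c * real m powr b))"
proof (rule summable_comparison_test_ev)
  \<comment> \<open>With \<open>b * k \<ge> p + 2\<close>, the exponential eventually beats the
    \<open>k\<close>-th power of \<open>m powr b\<close>, which absorbs \<open>m ^ p\<close> and
    leaves \<open>1 / m ^ 2\<close>.\<close>
  define k where "k = nat \<lceil>(real p + 2) / b\<rceil>"
  have "(real p + 2) / b \<le> real k" by (simp add: k_def of_nat_ceiling)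
  then have k: "real p + 2 \<le> b * real k" using assms by (simp add: field_simps)
  have "filterlim (\<lambda>m. c * exp (b * ln (real m))) at_top sequentially"
    using assms by (intro filterlim_tendsto_pos_mult_at_top[OF tendsto_const] filterlim_compose[OF exp_at_top]
        filterlim_compose[OF ln_at_top filterlim_real_sequentially]) auto
  moreover have "\<forall>\<^sub>F m in sequentially. c * exp (b * ln (real m)) = c * real m powr b"
    using eventually_gt_at_top[of 0] by eventually_elim (simp add: powr_def)
  ultimately have "filterlim (\<lambda>m. c * real m powr b) at_top sequentially"
    by (rule filterlim_mono_eventually[OF _ order_refl order_refl])
  from filterlim_compose[OF tendsto_power_div_exp_0 this]
  have "(\<lambda>m. (c * real m powr b) ^ k / exp (c * real m powr b)) \<longlonglongrightarrow> 0" .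
  then have "\<forall>\<^sub>F m in sequentially. (c * real m powr b) ^ k / exp (c * real m powr b) < c ^ k"
    by (rule order_tendstoD) (use assms in simp)
  then show "\<forall>\<^sub>F m in sequentially. norm (real m ^ p * exp (- c * real m powr b)) \<le> 1 / real m ^ 2"
    using eventually_gt_at_top[of 0]
  proof eventually_elim
    case (elim m)
    have "real m ^ p * real m ^ 2 = real m powr (real p + 2)"
      using elim by (simp add: powr_add powr_realpow)
    also have "\<dots> \<le> real m powr (b * real k)" using elim k by (intro powr_mono) auto
    also have "\<dots> = (real m powr b) powr real k" by (simp add: powr_powr)
    also have "\<dots> = (real m powr b) ^ k" using elim by (intro powr_realpow) simp
    also have "\<dots> < exp (c * real m powr b)"
      using elim assms by (simp add: power_mult_distrib field_simps)
    finally show ?case using elim by (simp add: exp_minus field_simps)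
  qed
  show "summable (\<lambda>m. 1 / real m ^ 2)"
    using inverse_power_summable[of 2, where 'a = real] by (simp add: inverse_eq_divide)
qed

text \<open>The polynomial factor leaves room for union bounds over boxes; the exponent
  \<open>b\<close> is \<open>1\<close> for missed targets and \<open>d - \<delta>\<close> for
  missing rich sites.\<close>

lemma (in prob_space) AE_eventually_not_mem:
  fixes b c C :: real
  assumes "\<And>m. B m \<in> events" "b > 0" "c > 0"
    and le: "\<forall>\<^sub>F m in sequentially. prob (B m) \<le> C * real m ^ p * exp (- c * real m powr b)"
  shows "AE \<omega> in M. \<forall>\<^sub>F m in sequentially. \<omega> \<notin> B m"
proof -
  have "summable (\<lambda>m. C * (real m ^ p * exp (- c * real m powr b)))"
    using summable_power_times_stretched_exp assms by (intro summable_mult) auto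
  then have "summable (\<lambda>m. prob (B m))"
    by (rule summable_comparison_test_ev[rotated])
      (use le in \<open>auto elim!: eventually_mono simp: mult.assoc\<close>)
  then have "AE \<omega> in M. \<forall>\<^sub>F m in sequentially. \<omega> \<in> space M - B m"
    using assms(1) by (intro borel_cantelli_AE1) (auto simp: emeasure_eq_measure)
  then show ?thesis by eventually_elim (auto elim: eventually_mono)
qed

section \<open>Almost sure properties of rich sites\<close>

text \<open>The type argument supplies the dimension. With exponent \<open>2 * L * m\<close>, at
  least \<open>(2d)^(L * m)\<close> walks are expected to follow a given geodesic of length at most
  \<open>L * m\<close>.\<close>

definition rich :: "'d itself \<Rightarrow> nat \<Rightarrow> nat \<Rightarrow> nat" where
  "rich _ L m = (2 * CARD('d)) ^ (2 * L * m)"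

lemma one_minus_power_le_exp:
  fixes q :: real
  assumes "q \<le> 1" "a \<le> q * real n"
  shows "(1 - q) ^ n \<le> exp (- a)"
proof -
  have "(1 - q) ^ n \<le> exp (- q) ^ n"
    using exp_ge_add_one_self[of "- q"] assms by (intro power_mono) auto
  also have "\<dots> = exp (- (q * real n))" by (simp add: exp_of_nat_mult[symmetric] mult.commute)
  also have "\<dots> \<le> exp (- a)" using assms by simp
  finally show ?thesis .
qed

lemma card_sup_box_le:
  assumes "1 \<le> m"
  shows "real (card (sup_box (c * m ^ p) :: (int ^ 'd) set))
    \<le> real (2 * c + 1) ^ CARD('d) * real m ^ (p * CARD('d))"
proof -
  have "1 \<le> m ^ p" using assms by simp
  then have "2 * (c * m ^ p) + 1 \<le> (2 * c + 1) * m ^ p" by (simp add: algebra_simps)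
  then have "card (sup_box (c * m ^ p) :: (int ^ 'd) set) \<le> ((2 * c + 1) * m ^ p) ^ CARD('d)"
    unfolding card_sup_box by (rule power_mono) simp
  also have "\<dots> = (2 * c + 1) ^ CARD('d) * m ^ (p * CARD('d))"
    by (simp only: power_mult_distrib power_mult)
  finally have "real (card (sup_box (c * m ^ p) :: (int ^ 'd) set))
      \<le> real ((2 * c + 1) ^ CARD('d) * m ^ (p * CARD('d)))"
    by (rule of_nat_mono)
  then show ?thesis by simp
qed

text \<open>Among \<open>m ^ d\<close> sites the expected number with at least
  \<open>b ^ (A * m)\<close> particles is at least
  \<open>A powr (- \<delta>) * m powr (d - \<delta>)\<close>, and the probability that there is none
  is at most the exponential of its negative.\<close>

lemma no_rich_site_prob_le:
  fixes \<delta> :: real and A b d :: nat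
  assumes A: "A \<ge> 1"
    and tail: "\<forall>\<^sub>F n in sequentially. real n powr (- \<delta>) \<le> measure_pmf.prob law {k. k \<ge> b ^ n}"
  shows "\<forall>\<^sub>F m in sequentially. (1 - measure_pmf.prob law {k. b ^ (A * m) \<le> k}) ^ (m ^ d)
           \<le> exp (- (real A powr (- \<delta>)) * real m powr (real d - \<delta>))"
proof -
  have "filterlim (\<lambda>m. A * m) at_top sequentially"
    using A by (intro mult_nat_left_at_top) simp
  from eventually_compose_filterlim[OF tail this] eventually_gt_at_top[of 0]
  show ?thesis
  proof eventually_elim
    case (elim m)
    let ?q = "measure_pmf.prob law {k. b ^ (A * m) \<le> k}"
    have "real A powr (- \<delta>) * real m powr (real d - \<delta>)
        = (real (A * m) powr (- \<delta>)) * (real m powr real d)"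
      by (simp add: powr_mult powr_add[symmetric])
    also have "real m powr real d = real (m ^ d)" using elim by (simp add: powr_realpow)
    also have "real (A * m) powr (- \<delta>) * real (m ^ d) \<le> ?q * real (m ^ d)"
      using elim by (intro mult_right_mono) auto
    finally show ?case using one_minus_power_le_exp[of ?q] by simp
  qed
qed

context frog_model
begin

lemma rich_sites_fast_AE:
  assumes L: "L \<ge> 1"
  shows "AE \<omega> in M. \<forall>\<^sub>F m in sequentially. \<forall>x\<in>sup_box (2 * m ^ CARD('d)).
     rich TYPE('d) L m \<le> eta x \<omega> \<longrightarrow>
       (\<forall>y. l1 (y - x) \<le> L * m \<longrightarrow> hit_time eta S \<omega> x y \<le> enat (l1 (y - x)))"
proof -
  let ?d = "CARD('d)"
  define R where "R = rich TYPE('d) L"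
  define V where "V m = {v \<in> sup_box (L * m) :: (int ^ 'd) set. l1 v \<le> L * m}" for m
  \<comment> \<open>\<open>E\<close> does not involve \<open>eta\<close>: the first
    \<open>R m\<close> walks are examined at every site, and richness only ensures that these
    particles exist. Targets are encoded as displacements \<open>v\<close>, so the index set is a
    product.\<close>
  define E where "E m = (\<lambda>(x, v). {\<omega> \<in> space M. \<forall>i\<in>{1..R m}. S x i (l1 (x + v - x)) \<omega> \<noteq> x + v})" for m
  define I :: "nat \<Rightarrow> ((int ^ 'd) \<times> (int ^ 'd)) set" where "I m = sup_box (2 * m ^ ?d) \<times> V m" for m
  define B where "B m = (\<Union>j\<in>I m. E m j)" for m
  have "1 \<le> real ?d" by simp
  then have d: "1 \<le> 2 * real ?d" by linarith
  have finV: "finite (V m)" for m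
    unfolding V_def by (rule finite_subset[OF _ finite_sup_box[of "L * m"]]) auto
  then have finI: "finite (I m)" for m
    unfolding I_def by (simp add: finite_sup_box)
  have evE: "E m j \<in> events" for m j
  proof -
    have "{\<omega> \<in> space M. \<forall>i\<in>{1..R m}. S x i n \<omega> \<noteq> y} \<in> events" for x y n
    proof (rule sets.sets_Collect_finite_All)
      fix i assume "i \<in> {1..R m}"
      then have "i \<ge> 1" by simp
      from walks_measurable[OF this] show "{\<omega> \<in> space M. S x i n \<omega> \<noteq> y} \<in> events"
        by measurable
    qed simp
    then show ?thesis unfolding E_def by (simp split: prod.split)
  qed
  have probE: "prob (E m j) \<le> exp (- 1 * real m powr 1)" if j: "j \<in> I m" and m: "m \<ge> 1" for m j
  proof -
    obtain x v where jx: "j = (x, v)" and v: "l1 v \<le> L * m"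
      using j by (auto simp: I_def V_def)
    have "prob (E m j) \<le> (1 - (1 / real (2 * ?d)) ^ l1 v) ^ R m"
      using all_walks_miss_prob[of "R m" x "x + v"] by (simp add: E_def jx)
    also have "\<dots> \<le> exp (- real m)"
    proof (rule one_minus_power_le_exp)
      show "(1 / real (2 * ?d)) ^ l1 v \<le> 1" using d by (intro power_le_one) auto
      \<comment> \<open>The expected number of walks along the geodesic is at least
        \<open>(2d)^(2 * L * m - l1 v)\<close>, hence at least \<open>(2d)^(L * m)\<close>; the
        crude lower bound \<open>m\<close> suffices and gives \<open>b = 1\<close>.\<close>
      have "real m \<le> 2 ^ m"
        using less_exp[of m] by (metis less_imp_le of_nat_le_iff of_nat_numeral of_nat_power)
      also have "(2::real) ^ m \<le> 2 ^ (L * m)" using L by (intro power_increasing) auto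
      also have "(2::real) ^ (L * m) \<le> real (2 * ?d) ^ (L * m)"
        using d by (intro power_mono) simp_all
      also have "\<dots> \<le> real (2 * ?d) ^ (2 * L * m - l1 v)"
      proof (rule power_increasing)
        show "1 \<le> real (2 * ?d)" using d by simp
      qed (use v in simp)
      also have "\<dots> = (1 / real (2 * ?d)) ^ l1 v * real (R m)"
        using v by (simp add: R_def rich_def power_diff power_one_over field_simps)
      finally show "real m \<le> (1 / real (2 * ?d)) ^ l1 v * real (R m)" .
    qed
    finally show ?thesis by simp
  qed
  have "AE \<omega> in M. \<forall>\<^sub>F m in sequentially. \<omega> \<notin> B m"
  proof (rule AE_eventually_not_mem)
    show "B m \<in> events" for m unfolding B_def using finI evE by blast
    \<comment> \<open>The degree \<open>d * d + d\<close> counts starting sites in a box of radius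
      \<open>2 * m ^ d\<close> and displacements in one of radius \<open>L * m\<close>.\<close>
    show "\<forall>\<^sub>F m in sequentially. prob (B m) \<le>
        (5 ^ ?d * real (2 * L + 1) ^ ?d) * real m ^ (?d * ?d + ?d) * exp (- 1 * real m powr 1)"
      using eventually_ge_at_top[of 1]
    proof eventually_elim
      case (elim m)
      have "prob (B m) \<le> (\<Sum>j\<in>I m. prob (E m j))"
        unfolding B_def using finI evE by (intro finite_measure_subadditive_finite) auto
      also have "\<dots> \<le> (\<Sum>j\<in>I m. exp (- 1 * real m powr 1))"
        using probE elim by (intro sum_mono) auto
      also have "\<dots> = real (card (sup_box (2 * m ^ ?d) :: (int ^ 'd) set)) 
          * real (card (V m)) * exp (- 1 * real m powr 1)"
        by (simp add: I_def card_cartesian_product)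
      also have "\<dots> \<le> (5 ^ ?d * real m ^ (?d * ?d)) * (real (2 * L + 1) ^ ?d * real m ^ ?d)
          * exp (- 1 * real m powr 1)"
      proof (intro mult_right_mono mult_mono)
        show "real (card (sup_box (2 * m ^ ?d) :: (int ^ 'd) set)) \<le> 5 ^ ?d * real m ^ (?d * ?d)"
          using card_sup_box_le[OF elim, of 2 ?d, where 'd = 'd] by simp
        have "card (V m) \<le> card (sup_box (L * m) :: (int ^ 'd) set)"
          unfolding V_def by (intro card_mono finite_sup_box) auto
        then show "real (card (V m)) \<le> real (2 * L + 1) ^ ?d * real m ^ ?d"
          using card_sup_box_le[OF elim, of L 1, where 'd = 'd] by simp
      qed auto
      finally show ?case by (simp add: power_add mult_ac)
    qed
  qed auto
  then show ?thesis
    using AE_space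
  proof eventually_elim
    case (elim \<omega>)
    from elim(1) show ?case
    proof eventually_elim
      case (elim m)
      show ?case
      proof (intro ballI impI allI)
        fix x y
        assume x: "x \<in> sup_box (2 * m ^ ?d)" and r: "rich TYPE('d) L m \<le> eta x \<omega>"
          and y: "l1 (y - x) \<le> L * m"
        then have "(x, y - x) \<in> I m" by (simp add: I_def V_def l1_le_imp_mem_sup_box)
        then have "\<omega> \<notin> E m (x, y - x)" using elim by (auto simp: B_def)
        then obtain i where "1 \<le> i" "i \<le> R m" "S x i (l1 (y - x)) \<omega> = y"
          using \<open>\<omega> \<in> space M\<close> by (auto simp: E_def)
        moreover have "R m \<le> eta x \<omega>" using r by (simp add: R_def)
        ultimately show "hit_time eta S \<omega> x y \<le> enat (l1 (y - x))"
          unfolding hit_time_le_iff by (meson order_refl order_trans)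
      qed
    qed
  qed
qed

text \<open>This supplies the \<open>near\<close> hypothesis of the chain: a cube of side
  \<open>m\<close> must offer a site of the next dyadic level \<open>2 * m\<close>. A union bound
  over the corners \<open>x\<close> costs only a polynomial factor.\<close>

lemma rich_site_nearby_AE:
  assumes L: "L \<ge> 1" and \<delta>: "\<delta> < real CARD('d)"
    and tail: "\<forall>\<^sub>F n in sequentially. real n powr (- \<delta>) \<le> measure_pmf.prob law {k. k \<ge> (2 * CARD('d)) ^ n}"
  shows "AE \<omega> in M. \<forall>\<^sub>F m in sequentially. \<forall>x\<in>sup_box (2 * m ^ CARD('d)).
     \<exists>z. (\<forall>k. z $ k - x $ k \<in> {0..<int m}) \<and> rich TYPE('d) L (2 * m) \<le> eta z \<omega>"
proof -
  let ?d = "CARD('d)"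
  define R where "R = rich TYPE('d) L"
  define Q where "Q m = {v :: int ^ 'd. \<forall>k. v $ k \<in> {0..<int m}}" for m
  define E where "E m x = {\<omega> \<in> space M. \<forall>z\<in>(+) x ` Q m. eta z \<omega> < R (2 * m)}" for m x
  define B where "B m = (\<Union>x\<in>sup_box (2 * m ^ ?d). E m x)" for m
  have Q: "finite (Q m)" "card (Q m) = m ^ ?d" for m
    unfolding Q_def using finite_vec_box[of "{0..<int m}"] card_vec_box[of "{0..<int m}"] by simp_all
  have evE: "E m x \<in> events" for m x
    unfolding E_def using Q(1) by (intro sets.sets_Collect_finite_All) auto
  have probE: "prob (E m x) = (1 - measure_pmf.prob law {k. (2 * ?d) ^ (4 * L * m) \<le> k}) ^ (m ^ ?d)" for m x
  proof -
    \<comment> \<open>Level \<open>2 * m\<close> has exponent \<open>2 * L * (2 * m)\<close>, so the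
      tail estimate is applied with \<open>A = 4 * L\<close>.\<close>
    have "R (2 * m) = (2 * ?d) ^ (4 * L * m)"
      unfolding R_def rich_def by (rule arg_cong[where f = "\<lambda>n. _ ^ n"]) simp
    moreover have "card ((+) x ` Q m) = m ^ ?d" using Q(2) by (simp add: card_image)
    ultimately show ?thesis
      unfolding E_def eta_all_less_prob[OF finite_imageI[OF Q(1)]] by simp
  qed
  have "AE \<omega> in M. \<forall>\<^sub>F m in sequentially. \<omega> \<notin> B m"
  proof (rule AE_eventually_not_mem)
    show "B m \<in> events" for m unfolding B_def using finite_sup_box evE by blast
    have "4 * L \<ge> 1" using L by simp
    from no_rich_site_prob_le[OF this tail, of ?d] eventually_ge_at_top[of 1]
    show "\<forall>\<^sub>F m in sequentially. prob (B m) \<le>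
        5 ^ ?d * real m ^ (?d * ?d) * exp (- (real (4 * L) powr (- \<delta>)) * real m powr (real ?d - \<delta>))"
    proof eventually_elim
      case (elim m)
      let ?e = "exp (- (real (4 * L) powr (- \<delta>)) * real m powr (real ?d - \<delta>))"
      have "prob (B m) \<le> (\<Sum>x\<in>sup_box (2 * m ^ ?d). prob (E m x))"
        unfolding B_def using finite_sup_box evE by (intro finite_measure_subadditive_finite) auto
      also have "\<dots> \<le> (\<Sum>x\<in>(sup_box (2 * m ^ ?d) :: (int ^ 'd) set). ?e)"
        unfolding probE using elim by (intro sum_mono) auto
      also have "\<dots> = real (card (sup_box (2 * m ^ ?d) :: (int ^ 'd) set)) * ?e"
        by simp
      also have "\<dots> \<le> (5 ^ ?d * real m ^ (?d * ?d)) * ?e"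
        using card_sup_box_le[OF elim(2), of 2 ?d, where 'd = 'd] by (intro mult_right_mono) auto
      finally show ?case .
    qed
  qed (use \<delta> L in auto)
  then show ?thesis
    using AE_space
  proof eventually_elim
    case (elim \<omega>)
    from elim(1) show ?case
    proof eventually_elim
      case (elim m)
      show ?case
      proof
        fix x :: "int ^ 'd" assume "x \<in> sup_box (2 * m ^ ?d)"
        then have "\<omega> \<notin> E m x" using elim by (auto simp: B_def)
        then obtain v where "v \<in> Q m" "R (2 * m) \<le> eta (x + v) \<omega>"
          using \<open>\<omega> \<in> space M\<close> by (auto simp: E_def not_less)
        then show "\<exists>z. (\<forall>k. z $ k - x $ k \<in> {0..<int m}) \<and> rich TYPE('d) L (2 * m) \<le> eta z \<omega>"
          by (intro exI[of _ "x + v"]) (simp add: Q_def R_def)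
      qed
    qed
  qed
qed

text \<open>This provides the site where the chain starts. Radius \<open>m ^ d\<close> is chosen so
  that the walk meets as many sites as a cube of side \<open>m\<close> contains.\<close>

lemma rich_site_visited_AE:
  assumes L: "L \<ge> 1" and \<delta>: "\<delta> < real CARD('d)"
    and tail: "\<forall>\<^sub>F n in sequentially. real n powr (- \<delta>) \<le> measure_pmf.prob law {k. k \<ge> (2 * CARD('d)) ^ n}"
  shows "AE \<omega> in M. \<forall>\<^sub>F m in sequentially. \<exists>n. l1 (S 0 1 n \<omega>) < m ^ CARD('d) \<and>
     rich TYPE('d) L m \<le> eta (S 0 1 n \<omega>) \<omega>"
proof -
  let ?d = "CARD('d)"
  define R where "R = rich TYPE('d) L"
  define B where "B m = {\<omega> \<in> space M. m ^ ?d \<le> card (visited (\<lambda>n. S 0 1 n \<omega>) (m ^ ?d)) \<and>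
      (\<forall>x\<in>visited (\<lambda>n. S 0 1 n \<omega>) (m ^ ?d). eta x \<omega> < R m)}" for m
  have "AE \<omega> in M. \<forall>\<^sub>F m in sequentially. \<omega> \<notin> B m"
  proof (rule AE_eventually_not_mem)
    show "B m \<in> events" for m unfolding B_def by (rule visited_all_less)
    have "2 * L \<ge> 1" using L by simp
    from no_rich_site_prob_le[OF this tail, of ?d]
    show "\<forall>\<^sub>F m in sequentially. prob (B m) \<le>
        1 * real m ^ 0 * exp (- (real (2 * L) powr (- \<delta>)) * real m powr (real ?d - \<delta>))"
    proof eventually_elim
      case (elim m)
      have "prob (B m) \<le> (1 - measure_pmf.prob law {k. (2 * ?d) ^ (2 * L * m) \<le> k}) ^ (m ^ ?d)"
        using visited_all_less(2)[of "m ^ ?d" "R m"] by (simp add: B_def R_def rich_def)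
      with elim show ?case by simp
    qed
  qed (use \<delta> L in auto)
  then show ?thesis
    using AE_space walk_AE[OF walk[OF order_refl, of 0]] walk_unbounded_AE[OF walk[OF order_refl, of 0]]
  proof eventually_elim
    case (elim \<omega>)
    \<comment> \<open>Almost every path is unbounded, so the cardinality clause in
      \<open>B m\<close> holds, and avoiding \<open>B m\<close> means that some visited site is
      rich.\<close>
    have card: "r \<le> card (visited (\<lambda>n. S 0 1 n \<omega>) r)" for r
    proof (rule card_visited_ge[where w = "\<lambda>n. S 0 1 n \<omega>"])
      show "finite (visited (\<lambda>n. S 0 1 n \<omega>) r)"
        by (rule finite_subset[OF _ finite_l1_ball[of r]]) (auto simp: visited_def)
    qed (use elim in \<open>auto simp: visited_def\<close>)
    from elim(1) show ?case
    proof eventually_elim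
      case (elim m)
      then show ?case
        using card[of "m ^ ?d"] \<open>\<omega> \<in> space M\<close> by (auto simp: B_def visited_def R_def not_less)
    qed
  qed
qed

end

section \<open>The shape\<close>

lemma compact_cross_polytope: "compact (cross_polytope :: (real ^ 'd) set)"
proof (rule compact_eq_bounded_closed[THEN iffD2], rule conjI)
  have "norm x \<le> 1" if "x \<in> cross_polytope" for x :: "real ^ 'd"
    using norm_le_l1_cart[of x] that by (simp add: cross_polytope_def)
  then show "bounded (cross_polytope :: (real ^ 'd) set)" by (auto simp: bounded_iff)
  show "closed (cross_polytope :: (real ^ 'd) set)"
    unfolding cross_polytope_def by (intro closed_Collect_le continuous_intros)
qed

lemma convex_cross_polytope: "convex (cross_polytope :: (real ^ 'd) set)"
proof (rule convexI)
  fix x y :: "real ^ 'd" and u v :: real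
  assume xy: "x \<in> cross_polytope" "y \<in> cross_polytope" and uv: "0 \<le> u" "0 \<le> v" "u + v = 1"
  have "(\<Sum>k\<in>UNIV. \<bar>(u *\<^sub>R x + v *\<^sub>R y) $ k\<bar>) \<le> (\<Sum>k\<in>UNIV. u * \<bar>x $ k\<bar> + v * \<bar>y $ k\<bar>)"
  proof (rule sum_mono)
    fix k show "\<bar>(u *\<^sub>R x + v *\<^sub>R y) $ k\<bar> \<le> u * \<bar>x $ k\<bar> + v * \<bar>y $ k\<bar>"
      using abs_triangle_ineq[of "u * x $ k" "v * y $ k"] uv by (simp add: abs_mult)
  qed
  also have "\<dots> = u * (\<Sum>k\<in>UNIV. \<bar>x $ k\<bar>) + v * (\<Sum>k\<in>UNIV. \<bar>y $ k\<bar>)"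
    by (simp add: sum.distrib sum_distrib_left)
  also have "\<dots> \<le> u * 1 + v * 1"
    using xy uv by (intro add_mono mult_left_mono) (auto simp: cross_polytope_def)
  finally show "u *\<^sub>R x + v *\<^sub>R y \<in> cross_polytope" using uv by (simp add: cross_polytope_def)
qed

lemma mem_scaled_cross_polytope:
  fixes x :: "real ^ 'd"
  assumes "0 < c" "(\<Sum>k\<in>UNIV. \<bar>x $ k\<bar>) \<le> c"
  shows "x \<in> (\<lambda>v. c *\<^sub>R v) ` cross_polytope"
proof
  show "x = c *\<^sub>R ((1 / c) *\<^sub>R x)" using assms by simp
  have "(\<Sum>k\<in>UNIV. \<bar>((1 / c) *\<^sub>R x) $ k\<bar>) = (\<Sum>k\<in>UNIV. \<bar>x $ k\<bar>) / c"
    using assms by (simp add: sum_divide_distrib abs_mult)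
  also have "\<dots> \<le> 1" using assms by (simp only: divide_le_eq_1_pos)
  finally show "(1 / c) *\<^sub>R x \<in> cross_polytope" by (simp only: cross_polytope_def mem_Collect_eq)
qed

section \<open>From lattice sets to regions of unit cells\<close>

lemma of_nat_l1: "real (l1 x) = (\<Sum>k\<in>UNIV. \<bar>real_of_int (x $ k)\<bar>)"
  by (simp add: l1_def)

text \<open>Passing from a site to a point of its cell changes each coordinate by at most
  \<open>1 / 2\<close>; the cruder bound \<open>1\<close> adds up to \<open>d\<close>, which is
  absorbed by \<open>\<epsilon> * n\<close>.\<close>

lemma awakened_region_subset:
  fixes eta :: "int ^ 'd \<Rightarrow> 'w \<Rightarrow> nat"
  assumes speed: "\<And>x i n. i \<ge> 1 \<Longrightarrow> l1 (S x i n \<omega> - x) \<le> n"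
    and "0 < \<epsilon>" and n: "0 < n" "real CARD('d) \<le> \<epsilon> * real n"
  shows "(\<lambda>v. (1 / real n) *\<^sub>R v) ` awakened_region eta S \<omega> n \<subseteq> (\<lambda>v. (1 + \<epsilon>) *\<^sub>R v) ` cross_polytope"
proof clarify
  fix w assume "w \<in> awakened_region eta S \<omega> n"
  then obtain x u where x: "x \<in> awakened eta S \<omega> n" and u: "u \<in> unit_cell"
    and w: "w = (\<chi> k. real_of_int (x $ k)) + u"
    by (auto simp: awakened_region_def)
  have "l1 x \<le> n"
    using l1_le_passage_time[of S \<omega> eta 0 x n] speed x by (simp add: awakened_def)
  have "(\<Sum>k\<in>UNIV. \<bar>w $ k\<bar>) \<le> (\<Sum>k\<in>UNIV. \<bar>real_of_int (x $ k)\<bar> + 1)"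
  proof (rule sum_mono)
    fix k
    have "- 1 / 2 < u $ k" "u $ k \<le> 1 / 2" using u by (auto simp: unit_cell_def)
    then show "\<bar>w $ k\<bar> \<le> \<bar>real_of_int (x $ k)\<bar> + 1" by (simp add: w)
  qed
  also have "\<dots> = real (l1 x) + real CARD('d)" by (simp add: sum.distrib of_nat_l1)
  also have "\<dots> \<le> real n + \<epsilon> * real n" using n \<open>l1 x \<le> n\<close> by (intro add_mono) auto
  finally have "(\<Sum>k\<in>UNIV. \<bar>((1 / real n) *\<^sub>R w) $ k\<bar>) \<le> 1 + \<epsilon>"
    using n(1) by (simp add: sum_divide_distrib[symmetric] field_simps)
  then show "(1 / real n) *\<^sub>R w \<in> (\<lambda>v. (1 + \<epsilon>) *\<^sub>R v) ` cross_polytope"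
    using \<open>0 < \<epsilon>\<close> by (intro mem_scaled_cross_polytope) auto
qed

lemma cross_polytope_subset_awakened_region:
  fixes eta :: "int ^ 'd \<Rightarrow> 'w \<Rightarrow> nat"
  assumes "\<epsilon> < 1" and n: "0 < n"
    and awake: "\<And>y. real (l1 y) \<le> (1 - \<epsilon>) * real n + real CARD('d) \<Longrightarrow> y \<in> awakened eta S \<omega> n"
  shows "(\<lambda>v. (1 - \<epsilon>) *\<^sub>R v) ` cross_polytope \<subseteq> (\<lambda>v. (1 / real n) *\<^sub>R v) ` awakened_region eta S \<omega> n"
proof clarify
  fix v :: "real ^ 'd" assume v: "v \<in> cross_polytope"
  define w where "w = (real n * (1 - \<epsilon>)) *\<^sub>R v"
  \<comment> \<open>Rounding to the centre of the cell containing \<open>w\<close>; the ceiling fits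
    cells that are open on the left and closed on the right.\<close>
  define y :: "int ^ 'd" where "y = (\<chi> k. \<lceil>w $ k - 1 / 2\<rceil>)"
  define u where "u = w - (\<chi> k. real_of_int (y $ k))"
  have cell: "- 1 / 2 < u $ k" "u $ k \<le> 1 / 2" for k
  proof -
    have "u $ k = w $ k - real_of_int \<lceil>w $ k - 1 / 2\<rceil>" by (simp add: u_def y_def)
    then show "- 1 / 2 < u $ k" "u $ k \<le> 1 / 2"
      using ceiling_correct[of "w $ k - 1 / 2"] by linarith+
  qed
  have "real (l1 y) \<le> (\<Sum>k\<in>UNIV. \<bar>w $ k\<bar> + 1)"
    unfolding of_nat_l1
  proof (rule sum_mono)
    fix k show "\<bar>real_of_int (y $ k)\<bar> \<le> \<bar>w $ k\<bar> + 1"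
      using cell[of k] by (simp add: u_def)
  qed
  also have "\<dots> = (real n * (1 - \<epsilon>)) * (\<Sum>k\<in>UNIV. \<bar>v $ k\<bar>) + real CARD('d)"
    using assms by (simp add: w_def sum.distrib sum_distrib_left abs_mult)
  also have "\<dots> \<le> (real n * (1 - \<epsilon>)) * 1 + real CARD('d)"
    using v assms by (intro add_mono mult_left_mono) (auto simp: cross_polytope_def)
  finally have "y \<in> awakened eta S \<omega> n" by (intro awake) (simp add: mult.commute)
  moreover have "u \<in> unit_cell" using cell by (simp add: unit_cell_def)
  moreover have "w = (\<chi> k. real_of_int (y $ k)) + u" by (simp add: u_def)
  ultimately have "w \<in> awakened_region eta S \<omega> n" unfolding awakened_region_def by blast
  moreover have "(1 - \<epsilon>) *\<^sub>R v = (1 / real n) *\<^sub>R w" using n by (simp add: w_def)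
  ultimately show "(1 - \<epsilon>) *\<^sub>R v \<in> (\<lambda>v. (1 / real n) *\<^sub>R v) ` awakened_region eta S \<omega> n" by blast
qed

theorem theorem1p3:
  fixes M :: "'w measure" and law :: "nat pmf"
    and eta :: "int ^ 'd \<Rightarrow> 'w \<Rightarrow> nat"
    and S :: "int ^ 'd \<Rightarrow> nat \<Rightarrow> nat \<Rightarrow> 'w \<Rightarrow> int ^ 'd"
    and \<delta> :: real
  assumes "frog_model M law eta S"
    and "\<forall>k\<in>set_pmf law. k \<ge> 1"
    and "0 < \<delta>" and "\<delta> < real CARD('d)"
    and "\<forall>\<^sub>F n in sequentially.
           measure_pmf.prob law {k. k \<ge> (2 * CARD('d)) ^ n} \<ge> real n powr (- \<delta>)"
  shows "asymptotic_shape M eta S (cross_polytope :: (real ^ 'd) set)"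
  unfolding asymptotic_shape_def
proof (intro conjI allI impI compact_cross_polytope convex_cross_polytope)
  interpret frog_model M law eta S by fact
  fix \<epsilon> :: real assume \<epsilon>: "0 < \<epsilon> \<and> \<epsilon> < 1"
  let ?d = "CARD('d)"
  \<comment> \<open>With this choice the detour \<open>4 * d * n / L\<close> is at most
    \<open>\<epsilon> * n / 2\<close>; the other half of \<open>\<epsilon> * n\<close> is kept for
    costs not growing with \<open>n\<close>.\<close>
  define L where "L = nat \<lceil>8 * real ?d / \<epsilon>\<rceil>"
  have "8 * real ?d / \<epsilon> \<le> real L" unfolding L_def by (rule of_nat_ceiling)
  then have L\<epsilon>: "8 * real ?d \<le> \<epsilon> * real L" using \<epsilon> by (simp add: field_simps)
  also have "\<dots> \<le> 1 * real L" using \<epsilon> by (intro mult_right_mono) auto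
  finally have L: "?d \<le> L" by simp
  have "0 < ?d" by simp
  with L have L1: "1 \<le> L" by linarith
  \<comment> \<open>At least one particle starts at the origin, so the walk \<open>S 0 1\<close>
    belongs to an existing frog that is active from time 0.\<close>
  have "AE k in distr M (count_space UNIV) (eta 0). 1 \<le> k"
    unfolding eta_law using assms(2) by (simp add: AE_measure_pmf_iff)
  then have eta0: "AE \<omega> in M. 1 \<le> eta 0 \<omega>" by (rule AE_distrD[OF eta_measurable])
  have "AE \<omega> in M. i \<ge> 1 \<longrightarrow> (\<forall>n. l1 (S x i n \<omega> - x) \<le> n)" for x i
    using walk_speed_AE[OF walk, of i x] by (cases "i \<ge> 1") auto
  then have speed: "AE \<omega> in M. \<forall>x i. i \<ge> 1 \<longrightarrow> (\<forall>n. l1 (S x i n \<omega> - x) \<le> n)"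
    by (simp add: AE_all_countable)
  show "AE \<omega> in M. \<forall>\<^sub>F n in sequentially.
      (\<lambda>v. (1 - \<epsilon>) *\<^sub>R v) ` (cross_polytope :: (real ^ 'd) set)
        \<subseteq> (\<lambda>v. (1 / real n) *\<^sub>R v) ` awakened_region eta S \<omega> n \<and>
      (\<lambda>v. (1 / real n) *\<^sub>R v) ` awakened_region eta S \<omega> n \<subseteq> (\<lambda>v. (1 + \<epsilon>) *\<^sub>R v) ` cross_polytope"
    using eta0 speed rich_sites_fast_AE[OF L1] rich_site_nearby_AE[OF L1 assms(4,5)]
      rich_site_visited_AE[OF L1 assms(4,5)]
  proof eventually_elim
    case (elim \<omega>)
    define R where "R = rich TYPE('d) L"
    \<comment> \<open>One random threshold \<open>m\<^sub>0\<close> serves all three properties: the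
      first two are used at every level from \<open>m\<^sub>0\<close> on, the visit to a rich site
      only at \<open>m\<^sub>0\<close>.\<close>
    have "\<forall>\<^sub>F m in sequentially.
        (\<forall>x\<in>sup_box (2 * m ^ ?d). R m \<le> eta x \<omega> \<longrightarrow>
          (\<forall>y. l1 (y - x) \<le> L * m \<longrightarrow> hit_time eta S \<omega> x y \<le> enat (l1 (y - x)))) \<and>
        (\<forall>x\<in>sup_box (2 * m ^ ?d). \<exists>z. (\<forall>k. z $ k - x $ k \<in> {0..<int m}) \<and> R (2 * m) \<le> eta z \<omega>) \<and>
        (\<exists>n. l1 (S 0 1 n \<omega>) < m ^ ?d \<and> R m \<le> eta (S 0 1 n \<omega>) \<omega>) \<and> 1 \<le> m"
      using elim(3-5) eventually_ge_at_top[of 1] unfolding R_def by (intro eventually_conj)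
    then obtain m\<^sub>0 where m0: "\<And>m. m\<^sub>0 \<le> m \<Longrightarrow>
        (\<forall>x\<in>sup_box (2 * m ^ ?d). R m \<le> eta x \<omega> \<longrightarrow>
          (\<forall>y. l1 (y - x) \<le> L * m \<longrightarrow> hit_time eta S \<omega> x y \<le> enat (l1 (y - x)))) \<and>
        (\<forall>x\<in>sup_box (2 * m ^ ?d). \<exists>z. (\<forall>k. z $ k - x $ k \<in> {0..<int m}) \<and> R (2 * m) \<le> eta z \<omega>) \<and>
        (\<exists>n. l1 (S 0 1 n \<omega>) < m ^ ?d \<and> R m \<le> eta (S 0 1 n \<omega>) \<omega>) \<and> 1 \<le> m"
      unfolding eventually_sequentially by blast
    then obtain T where T: "l1 (S 0 1 T \<omega>) < m\<^sub>0 ^ ?d" "R m\<^sub>0 \<le> eta (S 0 1 T \<omega>) \<omega>"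
      by blast
    have m0_1: "1 \<le> m\<^sub>0" using m0[of m\<^sub>0] by simp
    define x\<^sub>0 where "x\<^sub>0 = S 0 1 T \<omega>"
    have "hit_time eta S \<omega> 0 x\<^sub>0 \<le> enat T"
      using elim(1) unfolding hit_time_le_iff x\<^sub>0_def by blast
    then have reach: "passage_time eta S \<omega> 0 x\<^sub>0 \<le> enat T"
      using passage_time_step[of eta S \<omega> 0 0 0 x\<^sub>0 T] by (simp add: zero_enat_def)
    have x0: "x\<^sub>0 \<in> sup_box (m\<^sub>0 ^ ?d)" "R m\<^sub>0 \<le> eta x\<^sub>0 \<omega>"
      using T by (auto simp: x\<^sub>0_def intro: l1_le_imp_mem_sup_box)
    define C where "C = T + ?d * m\<^sub>0 ^ ?d"
    \<comment> \<open>\<open>C\<close> depends on \<open>\<omega>\<close> but not on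
      \<open>n\<close>; it collects the time \<open>T\<close> to reach the first rich site and the
      offset \<open>d * m\<^sub>0 ^ d\<close>. The extra \<open>d\<close> is the rounding error of
      the cells.\<close>
    have "\<forall>\<^sub>F n in sequentially. (real ?d + real C) * 2 / \<epsilon> \<le> real n"
      using filterlim_real_sequentially by (auto simp: filterlim_at_top)
    moreover have "\<forall>\<^sub>F n in sequentially. L * m\<^sub>0 \<le> n" "\<forall>\<^sub>F n :: nat in sequentially. 0 < n"
      by (rule eventually_ge_at_top eventually_gt_at_top)+
    ultimately show ?case
    proof eventually_elim
      case (elim n)
      have n: "2 * (real ?d + real C) \<le> \<epsilon> * real n" using elim(1) \<epsilon> by (simp add: field_simps)
      have "y \<in> awakened eta S \<omega> n" if y: "real (l1 y) \<le> (1 - \<epsilon>) * real n + real ?d" for y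
      proof (rule awakened_at_full_speed[where R = R and eta = eta and S = S and \<omega> = \<omega>,
            OF m0_1 L _ _ x0 reach elim(2)])
        \<comment> \<open>The budget, multiplied by \<open>L\<close>:
          \<open>(1 - \<epsilon>) * n\<close> for the distance, \<open>\<epsilon> * n / 2\<close>
          for the detour and \<open>\<epsilon> * n / 2\<close> for \<open>d + C\<close>.\<close>
        have "real (L * (l1 y + C) + 4 * ?d * n) = real L * (real (l1 y) + real C) + (4 * real ?d) * real n"
          by simp
        also have "\<dots> \<le> real L * ((1 - \<epsilon>) * real n + real ?d + real C) + (\<epsilon> * real L / 2) * real n"
          using y L\<epsilon> by (intro add_mono mult_left_mono mult_right_mono) auto
        also have "\<dots> = real L * ((1 - \<epsilon> / 2) * real n + (real ?d + real C))"
          by (simp add: algebra_simps)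
        also have "\<dots> \<le> real L * ((1 - \<epsilon> / 2) * real n + \<epsilon> * real n / 2)"
          using n by (intro mult_left_mono add_left_mono) auto
        also have "\<dots> = real (L * n)" by (simp add: algebra_simps)
        finally show "L * (l1 y + T + ?d * m\<^sub>0 ^ ?d) + 4 * ?d * n \<le> L * n"
          unfolding C_def of_nat_le_iff by (simp add: add.assoc)
      qed (use m0 in blast)+
      moreover have "real ?d \<le> \<epsilon> * real n"
        by (rule order_trans[OF _ n]) simp
      ultimately show ?case
        using \<epsilon> \<open>0 < n\<close> \<open>\<forall>x i. i \<ge> 1 \<longrightarrow> (\<forall>n. l1 (S x i n \<omega> - x) \<le> n)\<close>
        by (intro conjI cross_polytope_subset_awakened_region awakened_region_subset) auto
    qed
  qed
qed

end
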